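(* Let $0 \le \varepsilon < \tfrac12$ be fixed. The randomized (and the deterministic) two-party communication complexity of the following task is $\Omega(n^2)$: given a marriage market $(W,M,\succ_W,\succ_M)$ with full preference lists and $|W|=|M|=n$, where Alice holds the women's profile $\succ_W$ and Bob holds the men's profile $\succ_M$, output a perfect marriage between $W$ and $M$ that is $(1-\varepsilon)$-stable.
   Context: A marriage market with full preference lists consists of disjoint sets $W$ (women) and $M$ (men) with $|W|=|M|=n$, a profile $\succ_W$ giving each woman a total order on $M$, and a profile $\succ_M$ giving each man a total order on $W$. A perfect marriage is a bijection between $W$ and $M$, identified with its set of $n$ married pairs. A pair $(w,m)$ is blocking for a perfect marriage $\mu$ if $w$ prefers $m$ to her spouse in $\mu$ and $m$ prefers $w$ to his spouse in $\mu$; $\mu$ is stable if it has no blocking pair. The divorce distance between perfect marriages $\mu,\mu'$ is $d(\mu,\mu')=n-|\mu\cap\mu'|$, and $d(\mu)=\min_{\mu'} d(\mu,\mu')$ over all stable perfect marriages $\mu'$. $\mu$ is $(1-\varepsilon)$-stable if $d(\mu)\le \varepsilon n$. In two-party communication complexity, the cost of a protocol is the number of bits exchanged in the worst case over inputs; a randomized protocol must give a correct output with probability at least $2/3$ on every input; the complexity of a task is the least cost of a protocol solving it. The bound is asymptotic in $n$. *)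

theory Defs
  imports "HOL-Probability.Probability_Mass_Function" "HOL-Library.Extended_Nat"
begin

text \<open>Women and men are both identified with {0..<n}. A profile assigns to each
agent i < n a list ranking all n agents of the other side, most preferred first;
entries for i >= n are the empty list (canonical encoding).\<close>

definition pref_profile :: "nat \<Rightarrow> (nat \<Rightarrow> nat list) \<Rightarrow> bool" where
  "pref_profile n p \<longleftrightarrow>
     (\<forall>i<n. distinct (p i) \<and> set (p i) = {..<n}) \<and> (\<forall>i\<ge>n. p i = [])"

definition prefers :: "nat list \<Rightarrow> nat \<Rightarrow> nat \<Rightarrow> bool" where
  "prefers l a b \<longleftrightarrow> (\<exists>j k. j < k \<and> k < length l \<and> l ! j = a \<and> l ! k = b)"

text \<open>A perfect marriage: woman w < n is married to man mu w; mu is a bijection.\<close>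
definition perfect_marriage :: "nat \<Rightarrow> (nat \<Rightarrow> nat) \<Rightarrow> bool" where
  "perfect_marriage n mu \<longleftrightarrow> bij_betw mu {..<n} {..<n}"

definition marriage_pairs :: "nat \<Rightarrow> (nat \<Rightarrow> nat) \<Rightarrow> (nat \<times> nat) set" where
  "marriage_pairs n mu = {(w, mu w) | w. w < n}"

definition blocking ::
  "nat \<Rightarrow> (nat \<Rightarrow> nat list) \<Rightarrow> (nat \<Rightarrow> nat list) \<Rightarrow> (nat \<Rightarrow> nat) \<Rightarrow> nat \<Rightarrow> nat \<Rightarrow> bool" where
  "blocking n pW pM mu w m \<longleftrightarrow> w < n \<and> m < n \<and>
     prefers (pW w) m (mu w) \<and>
     (\<exists>w'. w' < n \<and> mu w' = m \<and> prefers (pM m) w w')"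

definition stable ::
  "nat \<Rightarrow> (nat \<Rightarrow> nat list) \<Rightarrow> (nat \<Rightarrow> nat list) \<Rightarrow> (nat \<Rightarrow> nat) \<Rightarrow> bool" where
  "stable n pW pM mu \<longleftrightarrow> perfect_marriage n mu \<and> \<not> (\<exists>w m. blocking n pW pM mu w m)"

definition divorce_dist :: "nat \<Rightarrow> (nat \<Rightarrow> nat) \<Rightarrow> (nat \<Rightarrow> nat) \<Rightarrow> nat" where
  "divorce_dist n mu mu' = n - card (marriage_pairs n mu \<inter> marriage_pairs n mu')"

text \<open>d(mu): minimum divorce distance to a stable perfect marriage
(stable marriages always exist by Gale--Shapley).\<close>
definition dist_stable ::
  "nat \<Rightarrow> (nat \<Rightarrow> nat list) \<Rightarrow> (nat \<Rightarrow> nat list) \<Rightarrow> (nat \<Rightarrow> nat) \<Rightarrow> nat" where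
  "dist_stable n pW pM mu = Min {divorce_dist n mu mu' | mu'. stable n pW pM mu'}"

definition almost_stable ::
  "real \<Rightarrow> nat \<Rightarrow> (nat \<Rightarrow> nat list) \<Rightarrow> (nat \<Rightarrow> nat list) \<Rightarrow> (nat \<Rightarrow> nat) \<Rightarrow> bool" where
  "almost_stable eps n pW pM mu \<longleftrightarrow>
     perfect_marriage n mu \<and> real (dist_stable n pW pM mu) \<le> eps * real n"

datatype ('a, 'b, 'o) protocol =
    Leaf 'o
  | AliceNode "'a \<Rightarrow> bool" "('a, 'b, 'o) protocol" "('a, 'b, 'o) protocol"
  | BobNode "'b \<Rightarrow> bool" "('a, 'b, 'o) protocol" "('a, 'b, 'o) protocol"

fun run :: "('a, 'b, 'o) protocol \<Rightarrow> 'a \<Rightarrow> 'b \<Rightarrow> 'o" where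
  "run (Leaf out) x y = out"
| "run (AliceNode f l r) x y = (if f x then run r x y else run l x y)"
| "run (BobNode g l r) x y = (if g y then run r x y else run l x y)"

fun bits :: "('a, 'b, 'o) protocol \<Rightarrow> 'a \<Rightarrow> 'b \<Rightarrow> nat" where
  "bits (Leaf out) x y = 0"
| "bits (AliceNode f l r) x y = Suc (if f x then bits r x y else bits l x y)"
| "bits (BobNode g l r) x y = Suc (if g y then bits r x y else bits l x y)"

type_synonym mm_protocol = "(nat \<Rightarrow> nat list, nat \<Rightarrow> nat list, nat \<Rightarrow> nat) protocol"

definition valid_inputs :: "nat \<Rightarrow> ((nat \<Rightarrow> nat list) \<times> (nat \<Rightarrow> nat list)) set" where
  "valid_inputs n = {(pW, pM). pref_profile n pW \<and> pref_profile n pM}"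

definition det_cost :: "nat \<Rightarrow> mm_protocol \<Rightarrow> enat" where
  "det_cost n P = (SUP xy \<in> valid_inputs n. enat (bits P (fst xy) (snd xy)))"

definition det_solves :: "real \<Rightarrow> nat \<Rightarrow> mm_protocol \<Rightarrow> bool" where
  "det_solves eps n P \<longleftrightarrow>
     (\<forall>(pW, pM) \<in> valid_inputs n. almost_stable eps n pW pM (run P pW pM))"

definition det_CC :: "real \<Rightarrow> nat \<Rightarrow> enat" where
  "det_CC eps n = (INF P \<in> {P. det_solves eps n P}. det_cost n P)"

text \<open>Randomized (public-coin) protocol: a probability distribution over
deterministic protocol trees. Cost: worst case over inputs and coin outcomes.\<close>
definition rand_cost :: "nat \<Rightarrow> mm_protocol pmf \<Rightarrow> enat" where
  "rand_cost n R = (SUP xy \<in> valid_inputs n. SUP P \<in> set_pmf R. enat (bits P (fst xy) (snd xy)))"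

definition rand_solves :: "real \<Rightarrow> nat \<Rightarrow> mm_protocol pmf \<Rightarrow> bool" where
  "rand_solves eps n R \<longleftrightarrow>
     (\<forall>(pW, pM) \<in> valid_inputs n.
        measure_pmf.prob R {P. almost_stable eps n pW pM (run P pW pM)} \<ge> 2/3)"

definition rand_CC :: "real \<Rightarrow> nat \<Rightarrow> enat" where
  "rand_CC eps n = (INF R \<in> {R. rand_solves eps n R}. rand_cost n R)"

end

theory Submission
  imports Defs
begin

text \<open>
  Unique disjointness on $m^2$ bits, with $m$ a small constant fraction of $n$, is encoded into a
  market in which a single common element of the two sets triggers a chain of rejections that
  changes the spouses of all but $2m$ women. Since $\varepsilon < 1/2$, no marriage is
  $\varepsilon$-close to stable marriages of both kinds, so a solution decides disjointness.

  Randomized hardness of unique disjointness follows from a corruption bound in the style of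
  Razborov. Draw a random partition of the ground set into $S$ and its complement, and random
  $a \subseteq S$, $b \subseteq U - S$; the intersecting inputs arise by putting one element $i$
  into both. A dense family of subsets of $S$ is nearly balanced in almost all coordinates (an
  exponential moment bound), so on every rectangle the intersecting mass is at least about the
  disjoint mass, up to an exponentially small error.
\<close>

subsection \<open>Communication protocols\<close>

text \<open>A single ranking can single out any subset of \<open>m\<close> agents, so the lists of
  \<open>m\<close> women, and likewise those of \<open>m\<close> men, hold an arbitrary set of
  pairs; this is the source of the quadratic bound. The task asks for a marriage, not a bit, and
  accepts any that is close to some stable one. The reduction must therefore control every stable
  marriage of the market and decide from the output alone. Corruption is used in linear form: a
  signed weight on input pairs, disjoint minus a multiple of intersecting, has only tiny positive
  mass on any rectangle, while the acceptance probabilities give it a constant fraction of the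
  total. Linearity carries it through protocol trees by additivity and through the coins by
  averaging.\<close>

text \<open>The inputs reaching a leaf form a rectangle, and at most \<open>2 ^ c\<close> leaves are
  involved. \<open>Phi\<close> may be negative, so its values are added leaf by leaf instead of
  using monotonicity.\<close>

lemma run_mass_le:
  fixes Phi :: "('a \<times> 'b) set \<Rightarrow> real" and P :: "('x, 'y, 'o) protocol"
  assumes empty: "Phi {} = 0"
    and add: "\<And>X Y. X \<inter> Y = {} \<Longrightarrow> Phi (X \<union> Y) = Phi X + Phi Y"
    and rect: "\<And>A B. A \<subseteq> U \<Longrightarrow> B \<subseteq> V \<Longrightarrow> Phi (A \<times> B) \<le> t"
    and AB: "A \<subseteq> U" "B \<subseteq> V"
    and cost: "\<And>a b. a \<in> A \<Longrightarrow> b \<in> B \<Longrightarrow> bits P (f a) (g b) \<le> c"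
  shows "Phi {(a, b). a \<in> A \<and> b \<in> B \<and> acc (run P (f a) (g b))} \<le> 2 ^ c * t"
  using AB cost
proof (induction P arbitrary: A B c)
  case (Leaf x)
  have t: "0 \<le> t" using rect[of "{}" "{}"] empty by simp
  have "Phi {(a, b). a \<in> A \<and> b \<in> B \<and> acc (run (Leaf x) (f a) (g b))} \<le> t"
  proof (cases "acc x")
    case True
    have "{(a, b). a \<in> A \<and> b \<in> B \<and> acc (run (Leaf x) (f a) (g b))} = A \<times> B"
      using True by auto
    then show ?thesis using rect Leaf by simp
  next
    case False
    then show ?thesis using t empty by simp
  qed
  also have "t \<le> 2 ^ c * t" using t by (simp add: mult_le_cancel_right1)
  finally show ?case .
next
  case (AliceNode h l r)
  have t: "0 \<le> t" using rect[of "{}" "{}"] empty by simp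
  let ?X = "\<lambda>A P. {(a, b). a \<in> A \<and> b \<in> B \<and> acc (run P (f a) (g b))}"
  let ?A1 = "{a \<in> A. h (f a)}" and ?A0 = "{a \<in> A. \<not> h (f a)}"
  show ?case
  \<comment> \<open>On an empty rectangle the cost hypothesis says nothing and \<open>c\<close>
    could be 0; otherwise this node spends a bit.\<close>
  proof (cases "A = {} \<or> B = {}")
    case True
    then have "?X A (AliceNode h l r) = {}" by blast
    then show ?thesis using t empty by (simp only:) simp
  next
    case False
    then obtain a b where ab: "a \<in> A" "b \<in> B" by blast
    obtain d where d: "c = Suc d" using AliceNode.prems(3)[OF ab] by (cases c) auto
    have split: "?X A (AliceNode h l r) = ?X ?A1 r \<union> ?X ?A0 l" by auto
    have 1: "Phi (?X A (AliceNode h l r)) = Phi (?X ?A1 r) + Phi (?X ?A0 l)"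
      unfolding split by (rule add) auto
    have 2: "Phi (?X ?A1 r) \<le> 2 ^ d * t"
    proof (rule AliceNode.IH(2))
      show "bits r (f a) (g b) \<le> d" if "a \<in> ?A1" "b \<in> B" for a b
        using AliceNode.prems(3)[of a b] that d by auto
    qed (use AliceNode.prems in auto)
    have 3: "Phi (?X ?A0 l) \<le> 2 ^ d * t"
    proof (rule AliceNode.IH(1))
      show "bits l (f a) (g b) \<le> d" if "a \<in> ?A0" "b \<in> B" for a b
        using AliceNode.prems(3)[of a b] that d by auto
    qed (use AliceNode.prems in auto)
    have "2 ^ d * t + 2 ^ d * t = 2 ^ c * t" using d by simp
    then show ?thesis using 1 2 3 by linarith
  qed
next
  case (BobNode h l r)
  have t: "0 \<le> t" using rect[of "{}" "{}"] empty by simp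
  let ?X = "\<lambda>B P. {(a, b). a \<in> A \<and> b \<in> B \<and> acc (run P (f a) (g b))}"
  let ?B1 = "{b \<in> B. h (g b)}" and ?B0 = "{b \<in> B. \<not> h (g b)}"
  show ?case
  proof (cases "A = {} \<or> B = {}")
    case True
    then have "?X B (BobNode h l r) = {}" by blast
    then show ?thesis using t empty by (simp only:) simp
  next
    case False
    then obtain a b where ab: "a \<in> A" "b \<in> B" by blast
    obtain d where d: "c = Suc d" using BobNode.prems(3)[OF ab] by (cases c) auto
    have split: "?X B (BobNode h l r) = ?X ?B1 r \<union> ?X ?B0 l" by auto
    have 1: "Phi (?X B (BobNode h l r)) = Phi (?X ?B1 r) + Phi (?X ?B0 l)"
      unfolding split by (rule add) auto
    have 2: "Phi (?X ?B1 r) \<le> 2 ^ d * t"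
    proof (rule BobNode.IH(2))
      show "bits r (f a) (g b) \<le> d" if "a \<in> A" "b \<in> ?B1" for a b
        using BobNode.prems(3)[of a b] that d by auto
    qed (use BobNode.prems in auto)
    have 3: "Phi (?X ?B0 l) \<le> 2 ^ d * t"
    proof (rule BobNode.IH(1))
      show "bits l (f a) (g b) \<le> d" if "a \<in> A" "b \<in> ?B0" for a b
        using BobNode.prems(3)[of a b] that d by auto
    qed (use BobNode.prems in auto)
    have "2 ^ d * t + 2 ^ d * t = 2 ^ c * t" using d by simp
    then show ?thesis using 1 2 3 by linarith
  qed
qed

text \<open>Averaging over the coins: a linear bound that holds for each deterministic tree survives
  in expectation, for weights of either sign.\<close>

lemma weighted_prob_sum_le:
  fixes R :: "'a pmf" and w :: "'e \<Rightarrow> real"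
  assumes "finite E"
    and le: "\<And>P. P \<in> set_pmf R \<Longrightarrow> (\<Sum>e \<in> E. w e * indicator (Q e) P) \<le> K"
  shows "(\<Sum>e \<in> E. w e * measure_pmf.prob R (Q e)) \<le> K"
proof -
  have int: "integrable (measure_pmf R) (\<lambda>P. w e * indicator (Q e) P)" for e
    by (intro integrable_mult_right measure_pmf.integrable_const_bound[where B = 1])
       (auto simp: indicator_def)
  have "(\<Sum>e \<in> E. w e * measure_pmf.prob R (Q e))
      = measure_pmf.expectation R (\<lambda>P. \<Sum>e \<in> E. w e * indicator (Q e) P)"
    using int by (subst Bochner_Integration.integral_sum) auto
  also have "\<dots> \<le> measure_pmf.expectation R (\<lambda>_. K)"
    by (rule integral_mono_AE) (auto intro!: int simp: AE_measure_pmf_iff le)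
  finally show ?thesis by simp
qed

subsection \<open>The corruption bound for unique disjointness\<close>

text \<open>Here \<^term>\<open>f S\<close> counts the members of a family that are subsets of \<^term>\<open>S\<close>, so that
  \<^term>\<open>f (S - {i})\<close> counts those among them that omit \<^term>\<open>i\<close>.\<close>

definition skewed :: "('a set \<Rightarrow> real) \<Rightarrow> 'a set \<Rightarrow> 'a \<Rightarrow> bool" where
  "skewed f S i \<longleftrightarrow>
     f S - f (S - {i}) < 9/10 * f (S - {i}) \<or> f (S - {i}) < 9/10 * (f S - f (S - {i}))"

section \<open>Reindexing of sums over a set and one of its elements\<close>

text \<open>Exchanges the players: \<open>a\<close> ranges inside \<open>S\<close> and
  \<open>b\<close> inside \<open>insert i (U - S)\<close>, and the involution on pairs
  \<open>(S, i)\<close> swaps these two sets.\<close>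

lemma sum_Pow_pair_involution:
  assumes "finite U"
  shows "(\<Sum>S \<in> Pow U. \<Sum>i \<in> S. F i S)
    = (\<Sum>S \<in> Pow U. \<Sum>i \<in> S. (F i (insert i (U - S)) :: real))"
proof -
  have fin: "\<forall>S \<in> Pow U. finite S" using assms finite_subset by blast
  have "(\<Sum>S \<in> Pow U. \<Sum>i \<in> S. F i S) = (\<Sum>(S, i) \<in> Sigma (Pow U) (\<lambda>S. S). F i S)"
    using assms fin by (simp add: sum.Sigma)
  also have "\<dots> = (\<Sum>(S, i) \<in> Sigma (Pow U) (\<lambda>S. S). F i (insert i (U - S)))"
    by (rule sum.reindex_bij_witness[where
          i = "\<lambda>(S, i). (insert i (U - S), i)" and j = "\<lambda>(S, i). (insert i (U - S), i)"])
       (auto intro!: arg_cong[where f = "F _"])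
  also have "\<dots> = (\<Sum>S \<in> Pow U. \<Sum>i \<in> S. F i (insert i (U - S)))"
    using assms fin by (simp add: sum.Sigma)
  finally show ?thesis .
qed

lemma sum_Pow_compl_pair:
  assumes "finite U"
  shows "(\<Sum>S \<in> Pow U. \<Sum>i \<in> U - S. F i S)
    = (\<Sum>S \<in> Pow U. \<Sum>i \<in> S. (F i (S - {i}) :: real))"
proof -
  have fin: "\<forall>S \<in> Pow U. finite S" using assms finite_subset by blast
  have "(\<Sum>S \<in> Pow U. \<Sum>i \<in> U - S. F i S) = (\<Sum>(S, i) \<in> Sigma (Pow U) (\<lambda>S. U - S). F i S)"
    using assms by (simp add: sum.Sigma)
  also have "\<dots> = (\<Sum>(S, i) \<in> Sigma (Pow U) (\<lambda>S. S). F i (S - {i}))"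
    by (rule sum.reindex_bij_witness[where
          i = "\<lambda>(S, i). (S - {i}, i)" and j = "\<lambda>(S, i). (insert i S, i)"]) auto
  also have "\<dots> = (\<Sum>S \<in> Pow U. \<Sum>i \<in> S. F i (S - {i}))"
    using assms fin by (simp add: sum.Sigma)
  finally show ?thesis .
qed

lemma sum_Pow_compl:
  "(\<Sum>S \<in> Pow U. F (U - S)) = (\<Sum>S \<in> Pow U. (F S :: real))"
  by (rule sum.reindex_bij_witness[where i = "\<lambda>S. U - S" and j = "\<lambda>S. U - S"]) auto

section \<open>The inequality between disjoint and intersecting mass, for set functions\<close>

text \<open>The term \<open>f S / 100\<close> is kept relative to the disjoint mass; the crude bound
  on \<open>g\<close> is affordable only in the \<open>th\<close> term, which is tiny.\<close>

lemma skewed_mass_le: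
  fixes f g :: "'a set \<Rightarrow> real"
  assumes U: "finite U"
    and gpos: "\<And>S. 0 \<le> g S"
    and gle: "\<And>S. S \<subseteq> U \<Longrightarrow> g S \<le> 2 ^ card S"
    and th: "0 \<le> th"
    and few: "\<And>S. S \<subseteq> U \<Longrightarrow>
      real (card {i \<in> S. skewed f S i}) * f S \<le> real (card U) * (f S / 100 + th * 2 ^ card S)"
  shows "(\<Sum>S \<in> Pow U. \<Sum>i \<in> S. if skewed f S i then f S * g (U - S) else 0)
    \<le> real (card U) * ((\<Sum>S \<in> Pow U. f S * g (U - S)) / 100 + th * 4 ^ card U)"
proof -
  have "(\<Sum>i \<in> S. if skewed f S i then f S * g (U - S) else 0)
      \<le> real (card U) * (f S * g (U - S) / 100 + th * 2 ^ card U)" if "S \<in> Pow U" for S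
  proof -
    have S: "finite S" "S \<subseteq> U" using that U finite_subset by auto
    have "(\<Sum>i \<in> S. if skewed f S i then f S * g (U - S) else 0)
        = real (card {i \<in> S. skewed f S i}) * f S * g (U - S)"
      using S by (simp add: sum.If_cases Int_def)
    also have "\<dots> \<le> real (card U) * (f S / 100 + th * 2 ^ card S) * g (U - S)"
      by (rule mult_right_mono[OF few[OF S(2)] gpos])
    also have "\<dots> = real (card U) * (f S * g (U - S) / 100 + th * (2 ^ card S * g (U - S)))"
      by (simp add: algebra_simps)
    also have "2 ^ card S * g (U - S) \<le> 2 ^ card S * 2 ^ card (U - S)"
      by (rule mult_left_mono) (auto intro: gle)
    also have "(2 :: real) ^ card S * 2 ^ card (U - S) = 2 ^ card U"
      using S U by (simp add: card_Diff_subset card_mono flip: power_add)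
    finally show ?thesis using th by (simp add: mult_left_mono)
  qed
  then have "(\<Sum>S \<in> Pow U. \<Sum>i \<in> S. if skewed f S i then f S * g (U - S) else 0)
      \<le> (\<Sum>S \<in> Pow U. real (card U) * (f S * g (U - S) / 100 + th * 2 ^ card U))"
    by (rule sum_mono)
  also have "\<dots> = real (card U) * ((\<Sum>S \<in> Pow U. f S * g (U - S)) / 100 + th * 4 ^ card U)"
    using U by (simp add: sum.distrib card_Pow sum_distrib_left sum_divide_distrib algebra_simps
        flip: power_mult_distrib)
  finally show ?thesis .
qed

text \<open>For \<open>i \<in> S\<close>, only \<open>x1 * y1\<close> is intersecting mass; the
  other three products of an \<open>x\<close> and a \<open>y\<close> are disjoint mass. Where
  neither side is skewed at \<open>i\<close>, the four agree up to constant factors, which ties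
  \<open>E11\<close> to the disjoint mass. Skewed places go into \<open>err\<close>.\<close>

lemma corruption_set_functions:
  fixes f g :: "'a set \<Rightarrow> real"
  assumes U: "finite U" "U \<noteq> {}"
    and fpos: "\<And>S. 0 \<le> f S" and gpos: "\<And>S. 0 \<le> g S"
    and fmono: "\<And>S T. S \<subseteq> T \<Longrightarrow> T \<subseteq> U \<Longrightarrow> f S \<le> f T"
    and gmono: "\<And>S T. S \<subseteq> T \<Longrightarrow> T \<subseteq> U \<Longrightarrow> g S \<le> g T"
    and fle: "\<And>S. S \<subseteq> U \<Longrightarrow> f S \<le> 2 ^ card S"
    and gle: "\<And>S. S \<subseteq> U \<Longrightarrow> g S \<le> 2 ^ card S"
    and th: "0 \<le> th"
    and ffew: "\<And>S. S \<subseteq> U \<Longrightarrow>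
      real (card {i \<in> S. skewed f S i}) * f S \<le> real (card U) * (f S / 100 + th * 2 ^ card S)"
    and gfew: "\<And>S. S \<subseteq> U \<Longrightarrow>
      real (card {i \<in> S. skewed g S i}) * g S \<le> real (card U) * (g S / 100 + th * 2 ^ card S)"
  shows "(\<Sum>S \<in> Pow U. f S * g (U - S))
    \<le> 6 / real (card U) *
        (\<Sum>S \<in> Pow U. \<Sum>i \<in> S. (f S - f (S - {i})) * (g (insert i (U - S)) - g (U - S)))
      + 12 * th * 4 ^ card U"
proof -
  let ?N = "real (card U)"
  let ?sum = "\<lambda>F. \<Sum>S \<in> Pow U. \<Sum>i \<in> S. (F S i :: real)"
  \<comment> \<open>For \<open>i \<in> S\<close>: \<open>x0\<close>, \<open>x1\<close> count the \<open>a \<subseteq> S\<close> without and with \<open>i\<close>;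
    \<open>y0\<close>, \<open>y1\<close> count the \<open>b \<subseteq> (U - S) \<union> {i}\<close> without and with \<open>i\<close>.\<close>
  define WD where "WD = (\<Sum>S \<in> Pow U. f S * g (U - S))"
  define x0 where "x0 S i = f (S - {i})" for S i
  define x1 where "x1 S i = f S - f (S - {i})" for S i
  define y0 where "y0 S i = g (U - S)" for S :: "'a set" and i :: 'a
  define y1 where "y1 S i = g (insert i (U - S)) - g (U - S)" for S i
  define bA where "bA S i = (if skewed f S i then f S * g (U - S) else 0)" for S i
  define bB where "bB S i = (if skewed g (insert i (U - S)) i
      then g (insert i (U - S)) * f (S - {i}) else 0)" for S i
  note defs = x0_def x1_def y0_def y1_def
  define E00 where "E00 = ?sum (\<lambda>S i. x0 S i * y0 S i)"
  define E01 where "E01 = ?sum (\<lambda>S i. x0 S i * y1 S i)"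
  define E10 where "E10 = ?sum (\<lambda>S i. x1 S i * y0 S i)"
  define E11 where "E11 = ?sum (\<lambda>S i. x1 S i * y1 S i)"
  define err where "err = ?N * (WD / 100 + th * 4 ^ card U)"
  have N: "0 < ?N" using U by (simp add: card_gt_0_iff)
  \<comment> \<open>An \<open>i\<close> outside \<open>S\<close> is moved into it by reindexing.
    Inputs that avoid \<open>i\<close> on both sides are met for \<open>i\<close> inside and for
    \<open>i\<close> outside, hence the factor 2.\<close>
  have total: "?N * WD = 2 * E00 + E10 + E01"
  proof -
    have "?N * WD = (\<Sum>S \<in> Pow U. \<Sum>i \<in> U. f S * g (U - S))"
      by (simp add: WD_def sum_distrib_left)
    also have "\<dots> = (\<Sum>S \<in> Pow U. (\<Sum>i \<in> U - S. f S * g (U - S)) + (\<Sum>i \<in> S. f S * g (U - S)))"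
      by (intro sum.cong refl sum.subset_diff) (use U in auto)
    also have "\<dots> = (\<Sum>S \<in> Pow U. \<Sum>i \<in> U - S. f S * g (U - S)) + ?sum (\<lambda>S i. f S * g (U - S))"
      by (rule sum.distrib)
    also have "(\<Sum>S \<in> Pow U. \<Sum>i \<in> U - S. f S * g (U - S))
        = ?sum (\<lambda>S i. f (S - {i}) * g (U - (S - {i})))"
      by (rule sum_Pow_compl_pair[OF U(1)])
    also have "\<dots> = ?sum (\<lambda>S i. x0 S i * y0 S i + x0 S i * y1 S i)"
    proof (intro sum.cong refl)
      fix S i assume "S \<in> Pow U" "i \<in> S"
      then have "U - (S - {i}) = insert i (U - S)" by auto
      then show "f (S - {i}) * g (U - (S - {i})) = x0 S i * y0 S i + x0 S i * y1 S i"
        by (simp add: defs algebra_simps)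
    qed
    also have "\<dots> = E00 + E01" by (simp add: E00_def E01_def sum.distrib)
    also have "?sum (\<lambda>S i. f S * g (U - S)) = ?sum (\<lambda>S i. x0 S i * y0 S i + x1 S i * y0 S i)"
      by (simp add: defs algebra_simps)
    also have "\<dots> = E00 + E10" by (simp add: E00_def E10_def sum.distrib)
    finally show ?thesis by simp
  qed
  have errA: "?sum bA \<le> err"
    unfolding bA_def err_def WD_def by (rule skewed_mass_le) (use assms in auto)
  have errB: "?sum bB \<le> err"
  proof -
    have "?sum bB = ?sum (\<lambda>S i. bB (insert i (U - S)) i)"
      using sum_Pow_pair_involution[OF U(1), of "\<lambda>i S. bB S i"] .
    also have "\<dots> = ?sum (\<lambda>S i. if skewed g S i then g S * f (U - S) else 0)"
    proof (intro sum.cong refl)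
      fix S i assume "S \<in> Pow U" "i \<in> S"
      then have "insert i (U - insert i (U - S)) = S" "insert i (U - S) - {i} = U - S" by auto
      then show "bB (insert i (U - S)) i = (if skewed g S i then g S * f (U - S) else 0)"
        by (simp add: bB_def)
    qed
    also have "\<dots> \<le> ?N * ((\<Sum>S \<in> Pow U. g S * f (U - S)) / 100 + th * 4 ^ card U)"
      by (rule skewed_mass_le) (use assms in auto)
    also have "(\<Sum>S \<in> Pow U. g S * f (U - S)) = (\<Sum>S \<in> Pow U. g (U - S) * f (U - (U - S)))"
      by (rule sum_Pow_compl[symmetric])
    also have "\<dots> = WD"
      unfolding WD_def by (intro sum.cong refl) (auto simp: double_diff mult.commute)
    finally show ?thesis by (simp add: err_def)
  qed
  \<comment> \<open>In a skewed place the error is \<open>(x0 + x1) * y0\<close> or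
    \<open>x0 * (y0 + y1)\<close>, which dominates the product left uncontrolled by the skew.
    Elsewhere the ratio 9/10 applies once or, for \<open>x1 * y1\<close>, twice.\<close>
  have pt: "x1 S i * y0 S i \<le> 10/9 * (x0 S i * y0 S i) + bA S i
      \<and> x0 S i * y1 S i \<le> 10/9 * (x0 S i * y0 S i) + bB S i
      \<and> 81/100 * (x0 S i * y0 S i - bA S i - bB S i) \<le> x1 S i * y1 S i"
    if "S \<in> Pow U" "i \<in> S" for S i
  proof -
    have S': "insert i (U - S) - {i} = U - S" using that by auto
    have pos: "0 \<le> x0 S i" "0 \<le> x1 S i" "0 \<le> y0 S i" "0 \<le> y1 S i"
      using fpos gpos fmono[of "S - {i}" S] gmono[of "U - S" "insert i (U - S)"] that
      by (auto simp: defs)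
    have bpos: "0 \<le> bA S i" "0 \<le> bB S i" using fpos gpos by (auto simp: bA_def bB_def)
    have A: "f S = x0 S i + x1 S i" and B: "g (insert i (U - S)) = y0 S i + y1 S i"
      and B0: "g (U - S) = y0 S i" and A0: "f (S - {i}) = x0 S i"
      by (auto simp: defs)
    have sA: "skewed f S i \<longleftrightarrow> x1 S i < 9/10 * x0 S i \<or> x0 S i < 9/10 * x1 S i"
      by (simp add: skewed_def defs)
    have sB: "skewed g (insert i (U - S)) i \<longleftrightarrow> y1 S i < 9/10 * y0 S i \<or> y0 S i < 9/10 * y1 S i"
      by (simp add: skewed_def S' defs)
    have pp: "0 \<le> x0 S i * y0 S i" "0 \<le> x1 S i * y0 S i" "0 \<le> x0 S i * y1 S i" "0 \<le> x1 S i * y1 S i"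
      using pos by auto
    have c1: "x1 S i * y0 S i \<le> 10/9 * (x0 S i * y0 S i) + bA S i"
    proof (cases "skewed f S i")
      case True
      then have "bA S i = x0 S i * y0 S i + x1 S i * y0 S i"
        unfolding bA_def A B0 by (simp add: algebra_simps)
      then show ?thesis using pp by linarith
    next
      case False
      then have "x1 S i * y0 S i \<le> 10/9 * x0 S i * y0 S i"
        by (intro mult_right_mono) (use pos sA in auto)
      then show ?thesis using bpos by simp
    qed
    have c2: "x0 S i * y1 S i \<le> 10/9 * (x0 S i * y0 S i) + bB S i"
    proof (cases "skewed g (insert i (U - S)) i")
      case True
      then have "bB S i = x0 S i * y0 S i + x0 S i * y1 S i"
        unfolding bB_def B A0 by (simp add: algebra_simps)
      then show ?thesis using pp by linarith
    next
      case False
      then have "x0 S i * y1 S i \<le> x0 S i * (10/9 * y0 S i)"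
        by (intro mult_left_mono) (use pos sB in auto)
      then show ?thesis using bpos by simp
    qed
    have c3: "81/100 * (x0 S i * y0 S i - bA S i - bB S i) \<le> x1 S i * y1 S i"
    proof -
      consider "skewed f S i" | "skewed g (insert i (U - S)) i"
        | "\<not> skewed f S i" "\<not> skewed g (insert i (U - S)) i" by blast
      then show ?thesis
      proof cases
        case 1
        then have "bA S i = x0 S i * y0 S i + x1 S i * y0 S i"
          unfolding bA_def A B0 by (simp add: algebra_simps)
        then have "81/100 * (x0 S i * y0 S i - bA S i - bB S i) \<le> 0" using pp bpos by simp
        then show ?thesis using pp by linarith
      next
        case 2
        then have "bB S i = x0 S i * y0 S i + x0 S i * y1 S i"
          unfolding bB_def B A0 by (simp add: algebra_simps)
        then have "81/100 * (x0 S i * y0 S i - bA S i - bB S i) \<le> 0" using pp bpos by simp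
        then show ?thesis using pp by linarith
      next
        case 3
        then have "(9/10 * x0 S i) * (9/10 * y0 S i) \<le> x1 S i * y1 S i"
          by (intro mult_mono) (use pos sA sB in auto)
        then show ?thesis using bpos by simp
      qed
    qed
    show ?thesis using c1 c2 c3 by blast
  qed
  have "E10 \<le> ?sum (\<lambda>S i. 10/9 * (x0 S i * y0 S i) + bA S i)"
    unfolding E10_def by (intro sum_mono) (use pt in blast)
  also have "\<dots> = 10/9 * E00 + ?sum bA"
    by (simp add: E00_def sum.distrib sum_distrib_left)
  finally have e10: "E10 \<le> 10/9 * E00 + err" using errA by linarith
  have "E01 \<le> ?sum (\<lambda>S i. 10/9 * (x0 S i * y0 S i) + bB S i)"
    unfolding E01_def by (intro sum_mono) (use pt in blast)
  also have "\<dots> = 10/9 * E00 + ?sum bB"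
    by (simp add: E00_def sum.distrib sum_distrib_left)
  finally have e01: "E01 \<le> 10/9 * E00 + err" using errB by linarith
  have "81/100 * (E00 - ?sum bA - ?sum bB)
      = ?sum (\<lambda>S i. 81/100 * (x0 S i * y0 S i - bA S i - bB S i))"
    by (simp only: E00_def sum_subtractf sum_distrib_left right_diff_distrib)
  also have "\<dots> \<le> E11"
    unfolding E11_def by (intro sum_mono) (use pt in blast)
  finally have "E00 - ?sum bA - ?sum bB \<le> 100/81 * E11" by simp
  then have e11: "E00 \<le> 100/81 * E11 + 2 * err" using errA errB by linarith
  have WD0: "0 \<le> WD" unfolding WD_def by (intro sum_nonneg mult_nonneg_nonneg fpos gpos)
  have E11pos: "0 \<le> E11"
    unfolding E11_def defs
    by (intro sum_nonneg mult_nonneg_nonneg) (auto intro!: fmono gmono)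
  have "?N * WD \<le> 38/9 * E00 + 2 * err" using total e10 e01 by linarith
  then have "?N * WD \<le> 3800/729 * E11 + 94/9 * err" using e11 by linarith
  moreover have "err = ?N * WD / 100 + ?N * (th * 4 ^ card U)"
    by (simp add: err_def algebra_simps)
  moreover have "0 \<le> ?N * WD" "0 \<le> ?N * (th * 4 ^ card U)"
    using WD0 th by simp_all
  \<comment> \<open>Moving the share \<open>94/900\<close> of \<open>?N * WD\<close> to the left
    leaves factors of about 5.82 and 11.7, rounded up to 6 and 12.\<close>
  ultimately have "?N * WD \<le> 6 * E11 + 12 * (?N * (th * 4 ^ card U))"
    using E11pos by linarith
  then have "WD \<le> 6 / ?N * E11 + 12 * (th * 4 ^ card U)"
    using N by (simp add: field_simps)
  then show ?thesis by (simp add: WD_def E11_def defs)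
qed

text \<open>The constant comes from the moment generating function of a fair coin at \<open>ln (11/10)\<close>, against a
  bias of \<open>10/19\<close>, which is what a ratio of \<open>9/10\<close> in \<^const>\<open>skewed\<close> amounts to.\<close>

definition skew_rate :: real where
  "skew_rate = (21/20) / (11/10) powr (10/19)"

lemma skew_rate_pos: "0 < skew_rate"
  by (simp add: skew_rate_def)

lemma skew_rate_less_1: "skew_rate < 1"
proof -
  \<comment> \<open>The 19th power clears the exponent: \<open>(21/20) ^ 19\<close> is about 2.53,
    \<open>(11/10) ^ 10\<close> about 2.59.\<close>
  have "(21/20 :: real) < (11/10) powr (10/19)"
  proof (rule power_less_imp_less_base)
    have "((11/10 :: real) powr (10/19)) ^ 19 = ((11/10) powr (10/19)) powr real 19"
      by (rule powr_realpow[symmetric]) simp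
    also have "\<dots> = (11/10) powr real 10"
      by (simp add: powr_powr)
    also have "\<dots> = (11/10) ^ 10"
      by (rule powr_realpow) simp
    finally have eq: "((11/10 :: real) powr (10/19)) ^ 19 = (11/10) ^ 10" .
    show "(21/20 :: real) ^ 19 < ((11/10) powr (10/19)) ^ 19"
      unfolding eq by (simp add: power_divide)
  qed simp
  then show ?thesis by (simp add: skew_rate_def)
qed

section \<open>Families with many unbalanced coordinates are small\<close>

text \<open>\<open>z a\<close> counts the coordinates of \<open>K\<close> where \<open>a\<close> is
  on the side \<open>dir\<close>. Its mean over \<open>A\<close> is at least \<open>p\<close>, so by
  convexity \<open>r ^ z a\<close> has mean at least \<open>r powr p\<close> there; over all of
  \<open>Pow S\<close> the mean is only \<open>(21/20) ^ card K\<close>. This limits the size of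
  \<open>A\<close>.\<close>

lemma card_le_if_skewed_coordinates:
  fixes A :: "'a set set"
  assumes S: "finite S" and A: "A \<subseteq> Pow S" and K: "K \<subseteq> S"
    and maj: "\<And>i. i \<in> K \<Longrightarrow> 10/19 * real (card A) \<le> real (card {a \<in> A. (i \<in> a) = dir i})"
  shows "real (card A) \<le> 2 ^ card S * skew_rate ^ card K"
proof -
  define r :: real where "r = 11/10"
  define p where "p = 10/19 * real (card K)"
  define z where "z a = card {i \<in> K. (i \<in> a) = dir i}" for a
  have fin: "finite A" "finite K" using S A K finite_subset by (auto intro: finite_subset)
  have "(\<Sum>a \<in> A. real (z a)) = (\<Sum>a \<in> A. \<Sum>i \<in> K. if (i \<in> a) = dir i then 1 else 0)"
    using fin by (intro sum.cong refl) (simp add: z_def sum.If_cases Int_def)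
  also have "\<dots> = (\<Sum>i \<in> K. \<Sum>a \<in> A. if (i \<in> a) = dir i then 1 else 0)"
    by (rule sum.swap)
  also have "\<dots> = (\<Sum>i \<in> K. real (card {a \<in> A. (i \<in> a) = dir i}))"
    using fin by (intro sum.cong refl) (simp add: sum.If_cases Int_def)
  also have "\<dots> \<ge> (\<Sum>i \<in> K. 10/19 * real (card A))"
    by (intro sum_mono maj)
  finally have zsum: "p * card A \<le> (\<Sum>a \<in> A. real (z a))"
    by (simp add: p_def mult_ac)
  \<comment> \<open>Jensen's inequality for \<open>r ^ z\<close>, through its tangent at \<open>p\<close>.\<close>
  have tangent: "r powr p * (1 + (real (z a) - p) * ln r) \<le> r ^ z a" for a
  proof -
    have "r ^ z a = r powr p * r powr (real (z a) - p)"
      by (simp add: r_def flip: powr_add powr_realpow)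
    also have "r powr (real (z a) - p) = exp ((real (z a) - p) * ln r)"
      by (simp add: powr_def r_def)
    also have "r powr p * \<dots> \<ge> r powr p * (1 + (real (z a) - p) * ln r)"
      by (intro mult_left_mono exp_ge_add_one_self) simp
    finally show ?thesis .
  qed
  have "0 \<le> ((\<Sum>a \<in> A. real (z a)) - p * card A) * ln r"
    using zsum by (simp add: r_def)
  then have "r powr p * card A \<le> r powr p * (card A + ((\<Sum>a \<in> A. real (z a)) - p * card A) * ln r)"
    by (intro mult_left_mono) auto
  also have "\<dots> = (\<Sum>a \<in> A. r powr p * (1 + (real (z a) - p) * ln r))"
    by (simp add: sum.distrib sum_subtractf flip: sum_distrib_left sum_distrib_right)
  also have "\<dots> \<le> (\<Sum>a \<in> A. r ^ z a)"
    by (intro sum_mono tangent)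
  also have "\<dots> \<le> (\<Sum>a \<in> Pow S. r ^ z a)"
    by (rule sum_mono2) (use S A in \<open>auto simp: r_def\<close>)
  also have "\<dots> = (\<Sum>a \<in> Pow S. (\<Prod>i \<in> a. if i \<in> K \<and> dir i then r else 1)
      * (\<Prod>i \<in> S - a. if i \<in> K \<and> \<not> dir i then r else 1))"
  proof (intro sum.cong refl)
    fix a assume "a \<in> Pow S"
    then have a: "finite a" "finite (S - a)" "a \<subseteq> S" using S finite_subset by auto
    have "{i \<in> K. (i \<in> a) = dir i} = {i \<in> a. i \<in> K \<and> dir i} \<union> {i \<in> S - a. i \<in> K \<and> \<not> dir i}"
      using K by auto
    then have "z a = card {i \<in> a. i \<in> K \<and> dir i} + card {i \<in> S - a. i \<in> K \<and> \<not> dir i}"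
      unfolding z_def by (simp only:) (rule card_Un_disjoint, use a in auto)
    then show "r ^ z a = (\<Prod>i \<in> a. if i \<in> K \<and> dir i then r else 1)
      * (\<Prod>i \<in> S - a. if i \<in> K \<and> \<not> dir i then r else 1)"
      using a by (simp add: prod.If_cases power_add Int_def)
  qed
  \<comment> \<open>Coordinates of a uniform subset are independent, so the sum over subsets is an
    expanded product, with a factor \<open>1 + r = 2 * 21/20\<close> for each coordinate in
    \<open>K\<close>.\<close>
  also have "\<dots> = (\<Prod>i \<in> S. (if i \<in> K \<and> dir i then r else 1) + (if i \<in> K \<and> \<not> dir i then r else 1))"
    by (rule prod_add[OF S, symmetric])
  also have "\<dots> = (\<Prod>i \<in> S. 2 * (if i \<in> K then 21/20 else 1))"
    by (intro prod.cong refl) (simp add: r_def)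
  also have "\<dots> = 2 ^ card S * (21/20) ^ card K"
    using S K by (simp add: prod.distrib prod.If_cases Int_absorb1)
  finally have "r powr p * card A \<le> 2 ^ card S * (21/20) ^ card K" .
  moreover have "r powr p = ((11/10) powr (10/19)) ^ card K"
    by (simp add: r_def p_def powr_powr flip: powr_realpow)
  ultimately show ?thesis
    by (simp add: skew_rate_def power_divide field_simps)
qed

text \<open>Either at most one percent of the coordinates are skewed, or the exponential bound makes
  the family sparse; the two terms on the right serve these two cases.\<close>

lemma few_skewed:
  fixes A :: "'a set set"
  assumes U: "finite U" and S: "S \<subseteq> U"
  defines "f \<equiv> \<lambda>T. real (card (A \<inter> Pow T))"
  shows "real (card {i \<in> S. skewed f S i}) * f S
    \<le> real (card U) * (f S / 100 + skew_rate powr (card U / 100) * 2 ^ card S)"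
proof -
  define K where "K = {i \<in> S. skewed f S i}"
  have finS: "finite S" using U S finite_subset by blast
  have KU: "card K \<le> card U" using U S by (intro card_mono) (auto simp: K_def)
  have f0: "0 \<le> f S" by (simp add: f_def)
  define dir where "dir i \<longleftrightarrow> f (S - {i}) < f S - f (S - {i})" for i
  have "f S \<le> 2 ^ card S * skew_rate ^ card K"
    unfolding f_def
  proof (rule card_le_if_skewed_coordinates)
    fix i assume i: "i \<in> K"
    have fin: "finite (A \<inter> Pow S)" using finS by auto
    have out: "{a \<in> A \<inter> Pow S. i \<notin> a} = A \<inter> Pow (S - {i})" by auto
    have "card (A \<inter> Pow S) = card {a \<in> A \<inter> Pow S. i \<in> a} + card {a \<in> A \<inter> Pow S. i \<notin> a}"
      using fin by (subst card_Un_disjoint[symmetric])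
        (auto intro: arg_cong[where f = card] elim: rev_finite_subset)
    then have eq: "f S = real (card {a \<in> A \<inter> Pow S. i \<in> a}) + f (S - {i})"
      unfolding f_def out by simp
    have pos: "0 \<le> f (S - {i})" by (simp add: f_def)
    have sk: "f S - f (S - {i}) < 9/10 * f (S - {i}) \<or> f (S - {i}) < 9/10 * (f S - f (S - {i}))"
      using i by (simp add: K_def skewed_def)
    show "10/19 * real (card (A \<inter> Pow S)) \<le> real (card {a \<in> A \<inter> Pow S. (i \<in> a) = dir i})"
    proof (cases "dir i")
      case True
      then have "10/19 * f S \<le> real (card {a \<in> A \<inter> Pow S. i \<in> a})"
        using eq sk pos by (auto simp: dir_def)
      then show ?thesis using True by (simp add: f_def)
    next
      case False
      then have "10/19 * f S \<le> f (S - {i})"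
        using eq sk pos by (auto simp: dir_def)
      moreover have "f (S - {i}) = real (card {a \<in> A \<inter> Pow S. i \<notin> a})"
        unfolding out f_def ..
      ultimately show ?thesis using False by (simp add: f_def)
    qed
  qed (use finS in \<open>auto simp: K_def\<close>)
  note fS = this
  show ?thesis
  proof (cases "real (card K) \<le> card U / 100")
    case True
    then have "real (card K) * f S \<le> card U / 100 * f S" using f0 by (rule mult_right_mono)
    also have "\<dots> \<le> card U * (f S / 100 + skew_rate powr (card U / 100) * 2 ^ card S)"
      by (simp add: algebra_simps)
    finally show ?thesis by (simp add: K_def)
  next
    case False
    have "skew_rate ^ card K = skew_rate powr card K"
      using skew_rate_pos by (simp add: powr_realpow)
    also have "\<dots> \<le> skew_rate powr (card U / 100)"
      using False skew_rate_pos skew_rate_less_1 by (intro powr_mono') auto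
    finally have "f S \<le> 2 ^ card S * skew_rate powr (card U / 100)"
      using fS by (smt (verit) mult_left_mono zero_le_power)
    then have "real (card K) * f S \<le> card U * (2 ^ card S * skew_rate powr (card U / 100))"
      using KU f0 by (intro mult_mono) auto
    also have "\<dots> \<le> card U * (f S / 100 + skew_rate powr (card U / 100) * 2 ^ card S)"
      using f0 by (intro mult_left_mono) auto
    finally show ?thesis by (simp add: K_def)
  qed
qed

text \<open>Up to normalisation, the probabilities of \<open>(a, b)\<close> under the distributions of disjoint and of
  uniquely intersecting inputs: the total masses are $4^N$ and $N 4^{N-1}$ for $N = |U|$.\<close>

definition disjoint_weight :: "'a set \<Rightarrow> 'a set \<Rightarrow> 'a set \<Rightarrow> real" where
  "disjoint_weight U a b = (\<Sum>S \<in> Pow U. of_bool (a \<subseteq> S) * of_bool (b \<subseteq> U - S))"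

definition intersecting_weight :: "'a set \<Rightarrow> 'a set \<Rightarrow> 'a set \<Rightarrow> real" where
  "intersecting_weight U a b = (\<Sum>(S, i) \<in> Sigma (Pow U) (\<lambda>S. S).
     of_bool (i \<in> a \<and> a \<subseteq> S) * of_bool (i \<in> b \<and> b \<subseteq> insert i (U - S)))"

section \<open>Supports, rectangle sums and total masses of the two weights\<close>

lemma disjoint_weight_nonneg: "0 \<le> disjoint_weight U a b"
  unfolding disjoint_weight_def by (intro sum_nonneg) simp

lemma intersecting_weight_nonneg: "0 \<le> intersecting_weight U a b"
  unfolding intersecting_weight_def by (intro sum_nonneg) auto

lemma disjoint_weight_eq_0:
  assumes "a \<inter> b \<noteq> {}"
  shows "disjoint_weight U a b = 0"
  unfolding disjoint_weight_def
proof (rule sum.neutral, rule ballI)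
  fix S assume "S \<in> Pow U"
  have "\<not> (a \<subseteq> S \<and> b \<subseteq> U - S)" using assms by blast
  then show "of_bool (a \<subseteq> S) * of_bool (b \<subseteq> U - S) = (0 :: real)" by auto
qed

text \<open>The containments for \<open>S\<close> and \<open>i\<close> force
  \<open>a \<inter> b = {i}\<close>, so this weight lives on uniquely intersecting pairs.\<close>

lemma intersecting_weight_eq_0:
  assumes "\<And>i. i \<in> U \<Longrightarrow> a \<inter> b \<noteq> {i}"
  shows "intersecting_weight U a b = 0"
  unfolding intersecting_weight_def
proof (rule sum.neutral, clarify)
  fix S i assume S: "S \<subseteq> U" "i \<in> S"
  have "\<not> (i \<in> a \<and> a \<subseteq> S \<and> i \<in> b \<and> b \<subseteq> insert i (U - S))"
  proof
    assume "i \<in> a \<and> a \<subseteq> S \<and> i \<in> b \<and> b \<subseteq> insert i (U - S)"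
    then have "a \<inter> b = {i}" by blast
    then show False using assms S by blast
  qed
  then show "of_bool (i \<in> a \<and> a \<subseteq> S) * of_bool (i \<in> b \<and> b \<subseteq> insert i (U - S)) = (0 :: real)"
    by auto
qed

text \<open>Given the hidden partition, the two players' sets are independent; a mixture of product
  weights factorises on a rectangle term by term.\<close>

lemma sum_Times_product:
  fixes p q :: "'t \<Rightarrow> 'a \<Rightarrow> real"
  shows "(\<Sum>(a, b) \<in> A \<times> B. \<Sum>t \<in> T. p t a * q t b) = (\<Sum>t \<in> T. sum (p t) A * sum (q t) B)"
proof -
  have "(\<Sum>(a, b) \<in> A \<times> B. \<Sum>t \<in> T. p t a * q t b) = (\<Sum>x \<in> A \<times> B. \<Sum>t \<in> T. p t (fst x) * q t (snd x))"
    by (simp add: case_prod_beta)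
  also have "\<dots> = (\<Sum>t \<in> T. \<Sum>x \<in> A \<times> B. p t (fst x) * q t (snd x))"
    by (rule sum.swap)
  also have "\<dots> = (\<Sum>t \<in> T. sum (p t) A * sum (q t) B)"
    by (simp add: sum_product sum.cartesian_product case_prod_beta)
  finally show ?thesis .
qed

lemma sum_of_bool_subset:
  assumes "finite A"
  shows "(\<Sum>a \<in> A. of_bool (a \<subseteq> S)) = real (card (A \<inter> Pow S))"
proof -
  have "A \<inter> {a. a \<subseteq> S} = A \<inter> Pow S" by auto
  then show ?thesis using assms by (simp add: of_bool_def sum.If_cases)
qed

lemma sum_of_bool_member_subset:
  assumes "finite A"
  shows "(\<Sum>a \<in> A. of_bool (i \<in> a \<and> a \<subseteq> S))
    = real (card (A \<inter> Pow S)) - real (card (A \<inter> Pow (S - {i})))"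
proof -
  have "(\<Sum>a \<in> A. of_bool (i \<in> a \<and> a \<subseteq> S)) + real (card (A \<inter> Pow (S - {i})))
      = (\<Sum>a \<in> A. of_bool (i \<in> a \<and> a \<subseteq> S) + of_bool (a \<subseteq> S - {i}))"
    by (simp only: sum.distrib sum_of_bool_subset[OF assms])
  also have "\<dots> = (\<Sum>a \<in> A. of_bool (a \<subseteq> S))"
    by (intro sum.cong refl) auto
  also have "\<dots> = real (card (A \<inter> Pow S))" by (rule sum_of_bool_subset[OF assms])
  finally show ?thesis by simp
qed

lemma disjoint_weight_rectangle:
  assumes "finite A" "finite B"
  shows "(\<Sum>(a, b) \<in> A \<times> B. disjoint_weight U a b)
    = (\<Sum>S \<in> Pow U. real (card (A \<inter> Pow S)) * real (card (B \<inter> Pow (U - S))))"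
  unfolding disjoint_weight_def sum_Times_product
  by (simp only: sum_of_bool_subset assms)

lemma intersecting_weight_rectangle:
  assumes "finite U" "finite A" "finite B"
  shows "(\<Sum>(a, b) \<in> A \<times> B. intersecting_weight U a b)
    = (\<Sum>S \<in> Pow U. \<Sum>i \<in> S. (real (card (A \<inter> Pow S)) - real (card (A \<inter> Pow (S - {i}))))
        * (real (card (B \<inter> Pow (insert i (U - S)))) - real (card (B \<inter> Pow (U - S)))))"
proof -
  have fin: "\<forall>S \<in> Pow U. finite S" using assms(1) finite_subset by blast
  have "(\<Sum>(a, b) \<in> A \<times> B. intersecting_weight U a b)
      = (\<Sum>(a, b) \<in> A \<times> B. \<Sum>t \<in> Sigma (Pow U) (\<lambda>S. S). of_bool (snd t \<in> a \<and> a \<subseteq> fst t)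
          * of_bool (snd t \<in> b \<and> b \<subseteq> insert (snd t) (U - fst t)))"
    unfolding intersecting_weight_def by (simp only: split_def)
  also have "\<dots> = (\<Sum>t \<in> Sigma (Pow U) (\<lambda>S. S).
      (\<Sum>a \<in> A. of_bool (snd t \<in> a \<and> a \<subseteq> fst t))
        * (\<Sum>b \<in> B. of_bool (snd t \<in> b \<and> b \<subseteq> insert (snd t) (U - fst t))))"
    by (rule sum_Times_product)
  also have "\<dots> = (\<Sum>(S, i) \<in> Sigma (Pow U) (\<lambda>S. S).
      (real (card (A \<inter> Pow S)) - real (card (A \<inter> Pow (S - {i}))))
        * (real (card (B \<inter> Pow (insert i (U - S)))) - real (card (B \<inter> Pow (U - S)))))"
  proof (rule sum.cong[OF refl], clarify)
    fix S i assume S: "S \<subseteq> U" "i \<in> S"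
    then have "insert i (U - S) - {i} = U - S" by auto
    then show "(\<Sum>a \<in> A. of_bool (snd (S, i) \<in> a \<and> a \<subseteq> fst (S, i)))
        * (\<Sum>b \<in> B. of_bool (snd (S, i) \<in> b \<and> b \<subseteq> insert (snd (S, i)) (U - fst (S, i))))
      = (real (card (A \<inter> Pow S)) - real (card (A \<inter> Pow (S - {i}))))
        * (real (card (B \<inter> Pow (insert i (U - S)))) - real (card (B \<inter> Pow (U - S))))"
      unfolding fst_conv snd_conv by (simp only: sum_of_bool_member_subset assms)
  qed
  also have "\<dots> = (\<Sum>S \<in> Pow U. \<Sum>i \<in> S.
      (real (card (A \<inter> Pow S)) - real (card (A \<inter> Pow (S - {i}))))
        * (real (card (B \<inter> Pow (insert i (U - S)))) - real (card (B \<inter> Pow (U - S)))))"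
    using assms(1) fin by (simp add: sum.Sigma)
  finally show ?thesis .
qed

lemma disjoint_weight_total:
  assumes "finite U"
  shows "(\<Sum>(a, b) \<in> Pow U \<times> Pow U. disjoint_weight U a b) = 4 ^ card U"
proof -
  have "(\<Sum>(a, b) \<in> Pow U \<times> Pow U. disjoint_weight U a b) = (\<Sum>S \<in> Pow U. 2 ^ card U)"
    unfolding disjoint_weight_rectangle[OF finite_Pow_iff[THEN iffD2, OF assms]
        finite_Pow_iff[THEN iffD2, OF assms]]
  proof (intro sum.cong refl)
    fix S assume "S \<in> Pow U"
    then have S: "S \<subseteq> U" "finite S" using assms finite_subset by auto
    then have "Pow U \<inter> Pow S = Pow S" "Pow U \<inter> Pow (U - S) = Pow (U - S)" by auto
    moreover have "(2 :: real) ^ card S * 2 ^ card (U - S) = 2 ^ card U"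
      using S assms by (simp add: card_Diff_subset card_mono flip: power_add)
    ultimately show "real (card (Pow U \<inter> Pow S)) * real (card (Pow U \<inter> Pow (U - S))) = 2 ^ card U"
      using S assms by (simp add: card_Pow)
  qed
  also have "\<dots> = 4 ^ card U"
    using assms by (simp add: card_Pow flip: power_mult_distrib)
  finally show ?thesis .
qed

lemma intersecting_weight_total:
  assumes "finite U"
  shows "4 * (\<Sum>(a, b) \<in> Pow U \<times> Pow U. intersecting_weight U a b) = real (card U) * 4 ^ card U"
proof -
  have fin: "finite (Pow U)" using assms by simp
  have "2 * (\<Sum>(a, b) \<in> Pow U \<times> Pow U. intersecting_weight U a b)
      = (\<Sum>S \<in> Pow U. \<Sum>i \<in> S. 2 ^ card U)"
    unfolding intersecting_weight_rectangle[OF assms fin fin] sum_distrib_left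
  proof (intro sum.cong refl)
    fix S i assume "S \<in> Pow U" and i: "i \<in> S"
    then have S: "S \<subseteq> U" "finite S" using assms finite_subset by auto
    have Int: "Pow U \<inter> Pow S = Pow S" "Pow U \<inter> Pow (S - {i}) = Pow (S - {i})"
      "Pow U \<inter> Pow (U - S) = Pow (U - S)" "Pow U \<inter> Pow (insert i (U - S)) = Pow (insert i (U - S))"
      using S i by auto
    have cS: "card S = Suc (card (S - {i}))" by (rule card.remove[OF S(2) i])
    have "card (insert i (U - S)) = Suc (card (U - S))" using i assms by simp
    then have cards: "real (card (Pow S)) = 2 * 2 ^ card (S - {i})"
      "real (card (Pow (S - {i}))) = 2 ^ card (S - {i})"
      "real (card (Pow (insert i (U - S)))) = 2 * 2 ^ card (U - S)"
      "real (card (Pow (U - S))) = 2 ^ card (U - S)"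
      using S assms cS by (simp_all add: card_Pow)
    have "(2 :: real) ^ card S * 2 ^ card (U - S) = 2 ^ card U"
      using S assms by (simp add: card_Diff_subset card_mono flip: power_add)
    then show "2 * ((real (card (Pow U \<inter> Pow S)) - real (card (Pow U \<inter> Pow (S - {i}))))
        * (real (card (Pow U \<inter> Pow (insert i (U - S)))) - real (card (Pow U \<inter> Pow (U - S)))))
      = 2 ^ card U"
      unfolding Int cards by (simp add: cS)
  qed
  also have "\<dots> = (\<Sum>S \<in> Pow U. real (card S)) * 2 ^ card U"
    by (simp add: sum_distrib_right)
  finally have 1: "2 * (\<Sum>(a, b) \<in> Pow U \<times> Pow U. intersecting_weight U a b)
      = (\<Sum>S \<in> Pow U. real (card S)) * 2 ^ card U" .
  have "2 * (\<Sum>S \<in> Pow U. real (card S))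
      = (\<Sum>S \<in> Pow U. real (card S)) + (\<Sum>S \<in> Pow U. real (card (U - S)))"
    using sum_Pow_compl[of "\<lambda>S. real (card S)" U] by simp
  also have "\<dots> = (\<Sum>S \<in> Pow U. real (card U))"
    unfolding sum.distrib[symmetric]
    by (intro sum.cong refl)
       (use assms in \<open>auto simp: card_Diff_subset card_mono finite_subset of_nat_diff\<close>)
  also have "\<dots> = real (card U) * 2 ^ card U" using assms by (simp add: card_Pow)
  finally have 2: "2 * (\<Sum>S \<in> Pow U. real (card S)) = real (card U) * 2 ^ card U" .
  have "4 * (\<Sum>(a, b) \<in> Pow U \<times> Pow U. intersecting_weight U a b)
      = 2 * (\<Sum>S \<in> Pow U. real (card S)) * 2 ^ card U" using 1 by simp
  also have "\<dots> = real (card U) * 4 ^ card U"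
    unfolding 2 by (simp flip: power_mult_distrib)
  finally show ?thesis .
qed

text \<open>The factor 6 means that the disjoint mass is at most $3/2$ times the intersecting mass. Any factor
  below 2 suffices for error probability $1/3$, so that no amplification is needed.\<close>

definition corruption_weight :: "'a set \<Rightarrow> 'a set \<Rightarrow> 'a set \<Rightarrow> real" where
  "corruption_weight U a b = disjoint_weight U a b - 6 / card U * intersecting_weight U a b"

lemma corruption_weight_rectangle_le:
  assumes U: "finite U" "U \<noteq> {}" and A: "A \<subseteq> Pow U" and B: "B \<subseteq> Pow U"
  shows "(\<Sum>(a, b) \<in> A \<times> B. corruption_weight U a b)
    \<le> 12 * skew_rate powr (card U / 100) * 4 ^ card U"
proof -
  have fin: "finite A" "finite B" using U A B by (auto intro: finite_subset)
  have le: "real (card (C \<inter> Pow S)) \<le> 2 ^ card S" if "S \<subseteq> U" for C S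
  proof -
    have S: "finite S" using that U finite_subset by auto
    then have "card (C \<inter> Pow S) \<le> card (Pow S)" by (intro card_mono) auto
    then have "card (C \<inter> Pow S) \<le> 2 ^ card S" using S by (simp add: card_Pow)
    then show ?thesis by (metis of_nat_le_iff of_nat_numeral of_nat_power)
  qed
  have mono: "real (card (C \<inter> Pow S)) \<le> real (card (C \<inter> Pow T))" if "S \<subseteq> T" "T \<subseteq> U" for C S T
  proof -
    have "finite T" using that U finite_subset by auto
    then show ?thesis using that by (auto intro!: card_mono)
  qed
  have "(\<Sum>(a, b) \<in> A \<times> B. corruption_weight U a b)
      = (\<Sum>(a, b) \<in> A \<times> B. disjoint_weight U a b)
        - 6 / card U * (\<Sum>(a, b) \<in> A \<times> B. intersecting_weight U a b)"
    by (simp add: corruption_weight_def case_prod_beta sum_subtractf sum_distrib_left)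
  also have "\<dots> \<le> 12 * skew_rate powr (card U / 100) * 4 ^ card U"
    unfolding disjoint_weight_rectangle[OF fin] intersecting_weight_rectangle[OF U(1) fin]
    using corruption_set_functions[OF U, of "\<lambda>S. real (card (A \<inter> Pow S))"
        "\<lambda>S. real (card (B \<inter> Pow S))" "skew_rate powr (card U / 100)"]
      le mono few_skewed[OF U(1)] by fastforce
  finally show ?thesis .
qed

text \<open>The acceptance probabilities, summed against the signed weight, give at least
  \<open>(2/3 - 6/4 * 1/3) * 4 ^ card U\<close>, a sixth of the total disjoint mass, and at most
  \<open>2 ^ c\<close> times the rectangle bound; \<open>72 = 6 * 12\<close>. The test
  \<open>acc\<close> sees only the output, so a search protocol can be plugged in.\<close>

theorem unique_disjointness_cost:
  fixes R :: "('x, 'y, 'o) protocol pmf" and f :: "'a set \<Rightarrow> 'x" and g :: "'a set \<Rightarrow> 'y"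
  assumes U: "finite U" "U \<noteq> {}"
    and cost: "\<And>P a b. P \<in> set_pmf R \<Longrightarrow> a \<subseteq> U \<Longrightarrow> b \<subseteq> U \<Longrightarrow> bits P (f a) (g b) \<le> c"
    and yes: "\<And>a b. a \<subseteq> U \<Longrightarrow> b \<subseteq> U \<Longrightarrow> a \<inter> b = {} \<Longrightarrow>
      2/3 \<le> measure_pmf.prob R {P. acc (run P (f a) (g b))}"
    and no: "\<And>a b i. a \<subseteq> U \<Longrightarrow> b \<subseteq> U \<Longrightarrow> a \<inter> b = {i} \<Longrightarrow>
      measure_pmf.prob R {P. acc (run P (f a) (g b))} \<le> 1/3"
  shows "1 \<le> 72 * 2 ^ c * skew_rate powr (card U / 100)"
proof -
  let ?E = "Pow U \<times> Pow U" and ?t = "12 * skew_rate powr (card U / 100) * 4 ^ card U"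
  let ?w = "\<lambda>(a, b). corruption_weight U a b"
  define Q where "Q = (\<lambda>(a, b). {P. acc (run P (f a) (g b))})"
  define Phi where "Phi X = (\<Sum>e \<in> X \<inter> ?E. ?w e)" for X
  have finE: "finite ?E" using U by simp
  have N: "0 < real (card U)" using U by (simp add: card_gt_0_iff)
  have upper: "(\<Sum>e \<in> ?E. ?w e * measure_pmf.prob R (Q e)) \<le> 2 ^ c * ?t"
  proof (rule weighted_prob_sum_le[OF finE])
    fix P assume P: "P \<in> set_pmf R"
    have "(\<Sum>e \<in> ?E. ?w e * indicator (Q e) P)
        = (\<Sum>e \<in> ?E. if e \<in> {(a, b). a \<in> Pow U \<and> b \<in> Pow U \<and> acc (run P (f a) (g b))} then ?w e else 0)"
      by (intro sum.cong refl) (auto simp: Q_def indicator_def)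
    also have "\<dots> = Phi {(a, b). a \<in> Pow U \<and> b \<in> Pow U \<and> acc (run P (f a) (g b))}"
      unfolding Phi_def using finE by (simp only: sum.inter_restrict Int_commute)
    also have "\<dots> \<le> 2 ^ c * ?t"
    proof (rule run_mass_le[where U = "Pow U" and V = "Pow U"])
      show "Phi {} = 0" by (simp add: Phi_def)
      show "Phi (X \<union> Y) = Phi X + Phi Y" if "X \<inter> Y = {}" for X Y
        unfolding Phi_def Int_Un_distrib2
        by (rule sum.union_disjoint) (use finE that in auto)
      show "Phi (A \<times> B) \<le> ?t" if "A \<subseteq> Pow U" "B \<subseteq> Pow U" for A B
      proof -
        have "(A \<times> B) \<inter> ?E = A \<times> B" using that by auto
        then show ?thesis
          unfolding Phi_def using corruption_weight_rectangle_le[OF U that] by simp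
      qed
    qed (use cost P in auto)
    finally show "(\<Sum>e \<in> ?E. ?w e * indicator (Q e) P) \<le> 2 ^ c * ?t" .
  qed
  have "(\<Sum>e \<in> ?E. (case e of (a, b) \<Rightarrow> disjoint_weight U a b) * (2/3)
        - 6 / card U * (case e of (a, b) \<Rightarrow> intersecting_weight U a b) * (1/3))
      \<le> (\<Sum>e \<in> ?E. ?w e * measure_pmf.prob R (Q e))"
  proof (rule sum_mono)
    fix e assume "e \<in> ?E"
    then obtain a b where e: "e = (a, b)" "a \<subseteq> U" "b \<subseteq> U" by auto
    let ?p = "measure_pmf.prob R (Q e)"
    have "disjoint_weight U a b * (2/3) \<le> disjoint_weight U a b * ?p"
    proof (cases "a \<inter> b = {}")
      case True
      then show ?thesis
        using yes[OF e(2,3)] by (intro mult_left_mono disjoint_weight_nonneg) (simp add: e Q_def)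
    qed (simp add: disjoint_weight_eq_0)
    moreover have "intersecting_weight U a b * ?p \<le> intersecting_weight U a b * (1/3)"
    proof (cases "\<exists>i. a \<inter> b = {i}")
      case True
      then have "?p \<le> 1/3" using no[OF e(2,3)] by (auto simp: e Q_def)
      then show ?thesis by (intro mult_left_mono intersecting_weight_nonneg)
    next
      case False
      then show ?thesis by (simp add: intersecting_weight_eq_0)
    qed
    then have "6 / card U * (intersecting_weight U a b * ?p)
        \<le> 6 / card U * (intersecting_weight U a b * (1/3))"
      by (rule mult_left_mono) simp
    ultimately show "(case e of (a, b) \<Rightarrow> disjoint_weight U a b) * (2/3)
        - 6 / card U * (case e of (a, b) \<Rightarrow> intersecting_weight U a b) * (1/3) \<le> ?w e * ?p"
      unfolding e(1) by (simp add: corruption_weight_def left_diff_distrib mult.assoc)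
  qed
  also have "(\<Sum>e \<in> ?E. (case e of (a, b) \<Rightarrow> disjoint_weight U a b) * (2/3)
        - 6 / card U * (case e of (a, b) \<Rightarrow> intersecting_weight U a b) * (1/3))
      = (\<Sum>(a, b) \<in> ?E. disjoint_weight U a b) * (2/3)
        - 6 / card U * (\<Sum>(a, b) \<in> ?E. intersecting_weight U a b) * (1/3)"
    by (simp only: sum_subtractf sum_distrib_left sum_distrib_right)
  also have "(\<Sum>(a, b) \<in> ?E. intersecting_weight U a b) = real (card U) * 4 ^ card U / 4"
    using intersecting_weight_total[OF U(1)] by simp
  also have "(\<Sum>(a, b) \<in> ?E. disjoint_weight U a b) * (2/3)
      - 6 / card U * (real (card U) * 4 ^ card U / 4) * (1/3) = 4 ^ card U / 6"
    unfolding disjoint_weight_total[OF U(1)] using N by (simp add: field_simps)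
  finally have "4 ^ card U / 6 \<le> 2 ^ c * ?t" using upper by linarith
  then have "4 ^ card U * 1 \<le> 4 ^ card U * (72 * 2 ^ c * skew_rate powr (card U / 100))"
    by (simp add: field_simps)
  then show ?thesis by (subst (asm) mult_le_cancel_left_pos) auto
qed

subsection \<open>The market\<close>

text \<open>Only a few positions in each list matter, so preferences are given by small numerical
  ranks, which sorting completes to a total order.\<close>

definition ranked_profile :: "nat \<Rightarrow> (nat \<Rightarrow> nat \<Rightarrow> nat) \<Rightarrow> nat \<Rightarrow> nat list" where
  "ranked_profile n r i = (if i < n then sort_key (r i) [0..<n] else [])"

lemma pref_profile_ranked_profile: "pref_profile n (ranked_profile n r)"
  by (auto simp: pref_profile_def ranked_profile_def)

lemma prefers_ranked_profileI:
  assumes "i < n" "x < n" "y < n" "r i x < r i y"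
  shows "prefers (ranked_profile n r i) x y"
proof -
  let ?l = "sort_key (r i) [0..<n]"
  obtain j where j: "j < length ?l" "?l ! j = x"
    using assms by (metis atLeastLessThan_iff in_set_conv_nth set_sort set_upt zero_le)
  obtain k where k: "k < length ?l" "?l ! k = y"
    using assms by (metis atLeastLessThan_iff in_set_conv_nth set_sort set_upt zero_le)
  have "j < k"
  proof (rule ccontr)
    assume "\<not> j < k"
    then have "map (r i) ?l ! k \<le> map (r i) ?l ! j"
      using j by (intro sorted_nth_mono) auto
    then show False using j k assms by simp
  qed
  then show ?thesis using j k assms by (auto simp: prefers_def ranked_profile_def)
qed

lemma prefers_ranked_profileD:
  assumes "prefers (ranked_profile n r i) x y"
  shows "r i x \<le> r i y" "x \<noteq> y"
proof -
  have "i < n" using assms by (auto simp: prefers_def ranked_profile_def split: if_splits)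
  then obtain j k where jk: "j < k" "k < length (sort_key (r i) [0..<n])"
    "sort_key (r i) [0..<n] ! j = x" "sort_key (r i) [0..<n] ! k = y"
    using assms by (auto simp: prefers_def ranked_profile_def)
  then have "map (r i) (sort_key (r i) [0..<n]) ! j \<le> map (r i) (sort_key (r i) [0..<n]) ! k"
    by (intro sorted_nth_mono) auto
  then show "r i x \<le> r i y" using jk by simp
  show "x \<noteq> y" using jk nth_eq_iff_index_eq[of "sort_key (r i) [0..<n]" j k] by auto
qed

lemma stable_rankedD:
  assumes "stable n (ranked_profile n rW) (ranked_profile n rM) mu"
    and "w < n" "w' < n" "rW w (mu w') < rW w (mu w)"
  shows "rM (mu w') w' \<le> rM (mu w') w"
proof (rule ccontr)
  assume neg: "\<not> ?thesis"
  have lt: "mu v < n" if "v < n" for v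
    using assms(1) that unfolding stable_def perfect_marriage_def bij_betw_def by auto
  have "prefers (ranked_profile n rW w) (mu w') (mu w)"
    using assms lt by (intro prefers_ranked_profileI) auto
  moreover have "prefers (ranked_profile n rM (mu w')) w w'"
    using assms lt neg by (intro prefers_ranked_profileI) auto
  ultimately have "blocking n (ranked_profile n rW) (ranked_profile n rM) mu w (mu w')"
    using assms lt by (auto simp: blocking_def)
  then show False using assms(1) by (auto simp: stable_def)
qed

text \<open>Agents of equal rank may be listed in either order; weak inequalities on both sides
  cover all cases.\<close>

lemma stable_rankedI:
  assumes "bij_betw mu {..<n} {..<n}"
    and "\<And>w w'. w < n \<Longrightarrow> w' < n \<Longrightarrow> w \<noteq> w' \<Longrightarrow> rW w (mu w') \<le> rW w (mu w) \<Longrightarrow>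
      rM (mu w') w \<le> rM (mu w') w' \<Longrightarrow> False"
  shows "stable n (ranked_profile n rW) (ranked_profile n rM) mu"
  unfolding stable_def perfect_marriage_def blocking_def
proof (intro conjI assms(1) notI, elim exE conjE)
  fix w x w'
  assume lt: "w < n" "w' < n" and x: "mu w' = x"
    and W: "prefers (ranked_profile n rW w) x (mu w)"
    and M: "prefers (ranked_profile n rM x) w w'"
  show False
    using assms(2)[OF lt] prefers_ranked_profileD[OF W] prefers_ranked_profileD[OF M] x by simp
qed

text \<open>
  With \<open>n = L + 2 * m\<close>, the women are \<open>c\<^sub>k = k\<close> (\<open>k < L\<close>), \<open>u\<^sub>i = L + i\<close> and \<open>t\<^sub>j = L + m + j\<close>
  (\<open>i, j < m\<close>), and the men are \<open>d\<^sub>k = k\<close>, \<open>s\<^sub>i = L + i\<close> and \<open>v\<^sub>j = L + m + j\<close>. Bit \<open>(i, j)\<close> of the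
  sets says whether \<open>u\<^sub>i\<close> prefers \<open>v\<^sub>j\<close> to her default \<open>s\<^sub>i\<close>, and whether \<open>v\<^sub>j\<close> prefers \<open>u\<^sub>i\<close> to his
  default \<open>t\<^sub>j\<close>. If \<open>u\<^sub>i\<close> and \<open>v\<^sub>j\<close> elope, then \<open>t\<^sub>j\<close> takes \<open>d\<^sub>0\<close> from \<open>c\<^sub>0\<close>, who takes \<open>d\<^sub>1\<close> from
  \<open>c\<^sub>1\<close>, and so on, until the last woman of the chain marries the abandoned \<open>s\<^sub>i\<close>.
  Rank 0 is best; ties are broken by index and never matter.
\<close>

definition women_rank :: "nat \<Rightarrow> nat \<Rightarrow> (nat \<times> nat) set \<Rightarrow> nat \<Rightarrow> nat \<Rightarrow> nat" where
  "women_rank L m a w x =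
    (if w < L then
       if x = w then 0
       else if (if Suc w < L then x = Suc w else L \<le> x \<and> x < L + m) then 1 else 2
     else if w < L + m then
       if L + m \<le> x \<and> (w - L, x - L - m) \<in> a then 0 else if x = w then 1 else 2
     else
       if x = w then 0 else if x = 0 then 1 else 2)"

definition men_rank :: "nat \<Rightarrow> nat \<Rightarrow> (nat \<times> nat) set \<Rightarrow> nat \<Rightarrow> nat \<Rightarrow> nat" where
  "men_rank L m b x w =
    (if x = 0 then
       if L + m \<le> w then 0 else if w = 0 then 1 else 2
     else if x < L then
       if w = x - 1 then 0 else if w = x then 1 else 2
     else if x < L + m then
       if w = x then 0 else if w = L - 1 then 1 else 2
     else
       if L \<le> w \<and> w < L + m \<and> (w - L, x - L - m) \<in> b then 0 else if w = x then 1 else 2)"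

abbreviation women_profile :: "nat \<Rightarrow> nat \<Rightarrow> (nat \<times> nat) set \<Rightarrow> nat \<Rightarrow> nat list" where
  "women_profile L m a \<equiv> ranked_profile (L + 2 * m) (women_rank L m a)"

abbreviation men_profile :: "nat \<Rightarrow> nat \<Rightarrow> (nat \<times> nat) set \<Rightarrow> nat \<Rightarrow> nat list" where
  "men_profile L m b \<equiv> ranked_profile (L + 2 * m) (men_rank L m b)"

section \<open>Stable marriages in the disjoint and the intersecting market\<close>

text \<open>Under \<open>id\<close> every \<open>c_k\<close> and \<open>t_j\<close> has her first
  choice, so only some \<open>u_i\<close> can want another man, a \<open>v_j\<close> with
  \<open>(i, j)\<close> in \<open>a\<close>; he agrees only if the pair is in \<open>b\<close>
  too.\<close>

lemma stable_id_if_disjoint: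
  assumes "0 < L" "a \<inter> b = {}"
  shows "stable (L + 2 * m) (women_profile L m a) (men_profile L m b) id"
proof (rule stable_rankedI)
  fix w w'
  assume "w < L + 2 * m" "w' < L + 2 * m" "w \<noteq> w'"
    "women_rank L m a w (id w') \<le> women_rank L m a w (id w)"
    "men_rank L m b (id w') w \<le> men_rank L m b (id w') w'"
  then show False
    using assms by (auto simp: women_rank_def men_rank_def split: if_splits)
qed simp

text \<open>Distance is to the nearest stable marriage, so all of them must be controlled. Each
  \<open>t_j\<close> keeps \<open>v_j\<close>, hence no \<open>t_j\<close> takes \<open>d_0\<close>
  from \<open>c_0\<close>, and the chain stays in place woman by woman.\<close>

lemma stable_fixes_chain_if_disjoint:
  assumes L: "0 < L" and disj: "a \<inter> b = {}"
    and st: "stable (L + 2 * m) (women_profile L m a) (men_profile L m b) mu"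
    and "k < L"
  shows "mu k = k"
proof -
  let ?n = "L + 2 * m"
  note D = stable_rankedD[OF st]
  have bij: "bij_betw mu {..<?n} {..<?n}" using st by (simp add: stable_def perfect_marriage_def)
  have ex: "\<exists>v < ?n. mu v = x" if "x < ?n" for x
    using bij that unfolding bij_betw_def by (metis imageE lessThan_iff)
  \<comment> \<open>If he had gone to some \<open>u\<close>, the bit would be in \<open>b\<close>,
    hence not in \<open>a\<close>; \<open>u\<close> would prefer her default, who ranks her
    first.\<close>
  have t: "mu t = t" if tge: "L + m \<le> t" and tlt: "t < ?n" for t
  proof (rule ccontr)
    assume neq: "mu t \<noteq> t"
    obtain u where u: "u < ?n" "mu u = t" using ex[OF tlt] by blast
    have "men_rank L m b t u \<le> men_rank L m b t t"
      using D[of t u] tge tlt u neq by (auto simp: women_rank_def)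
    then have ub: "L \<le> u" "u < L + m" "(u - L, t - L - m) \<in> b"
      using tge tlt L u neq by (auto simp: men_rank_def split: if_splits)
    then have na: "(u - L, t - L - m) \<notin> a" using disj by blast
    obtain v where v: "v < ?n" "mu v = u" using ex[OF u(1)] by blast
    have "v \<noteq> u" using v u ub tge tlt by auto
    moreover have "men_rank L m b u v \<le> men_rank L m b u u"
      using D[of u v] v u ub na tge tlt by (auto simp: women_rank_def)
    ultimately show False using ub L by (auto simp: men_rank_def split: if_splits)
  qed
  show ?thesis using \<open>k < L\<close>
  proof (induction k)
    case 0
    show ?case
    proof (rule ccontr)
      assume neq: "mu 0 \<noteq> 0"
      obtain u where u: "u < ?n" "mu u = 0" using ex L by (metis add_gr_0)
      have "men_rank L m b 0 u \<le> men_rank L m b 0 0"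
        using D[of 0 u] L u neq by (auto simp: women_rank_def)
      then have "L + m \<le> u" using L u neq by (auto simp: men_rank_def split: if_splits)
      then show False using t[of u] u L by simp
    qed
  next
    case (Suc k)
    show ?case
    proof (rule ccontr)
      assume neq: "mu (Suc k) \<noteq> Suc k"
      obtain u where u: "u < ?n" "mu u = Suc k" using ex[of "Suc k"] Suc.prems by auto
      have "men_rank L m b (Suc k) u \<le> men_rank L m b (Suc k) (Suc k)"
        using D[of "Suc k" u] Suc.prems u neq by (auto simp: women_rank_def)
      then have "u = k" using Suc.prems u neq by (auto simp: men_rank_def split: if_splits)
      then show False using u Suc by simp
    qed
  qed
qed

text \<open>Uniqueness forces \<open>u_i\<close> to marry \<open>v_j\<close>: a rival match that
  keeps either of them satisfied rests on a bit in only one of the sets, and then a default couple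
  blocks. Each displaced woman displaces the next.\<close>

lemma stable_shifts_chain_if_intersecting:
  assumes L: "0 < L" and int: "a \<inter> b = {(i, j)}" and ij: "i < m" "j < m"
    and st: "stable (L + 2 * m) (women_profile L m a) (men_profile L m b) mu"
    and "k < L"
  shows "mu k \<noteq> k"
proof -
  let ?n = "L + 2 * m"
  note D = stable_rankedD[OF st]
  have bij: "bij_betw mu {..<?n} {..<?n}" using st by (simp add: stable_def perfect_marriage_def)
  have ex: "\<exists>v < ?n. mu v = x" if "x < ?n" for x
    using bij that unfolding bij_betw_def by (metis imageE lessThan_iff)
  have lt: "mu v < ?n" if "v < ?n" for v
    using bij that unfolding bij_betw_def by auto
  define p where "p = L + i"
  define q where "q = L + m + j"
  have p: "L \<le> p" "p < L + m" "p < ?n" and q: "L + m \<le> q" "q < ?n"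
    using ij by (auto simp: p_def q_def)
  have pq: "(p - L, q - L - m) \<in> a" "(p - L, q - L - m) \<in> b" using int by (auto simp: p_def q_def)
  have only: "u = p \<and> x = q" if "L \<le> u" "L + m \<le> x" "(u - L, x - L - m) \<in> a"
    "(u - L, x - L - m) \<in> b" for u x
  proof -
    have "(u - L, x - L - m) \<in> a \<inter> b" using that by blast
    then have "u - L = i" "x - L - m = j" using int by auto
    then show ?thesis using that by (auto simp: p_def q_def)
  qed
  have mu_p: "mu p = q"
  proof (rule ccontr)
    assume neq: "mu p \<noteq> q"
    obtain u where u: "u < ?n" "mu u = q" using ex q by blast
    consider "women_rank L m a p (mu p) \<le> women_rank L m a p q"
      | "men_rank L m b q u \<le> men_rank L m b q p"
      using D[of p u] p u by force
    then show False
    proof cases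
      case 1
      then have x: "L + m \<le> mu p" "(p - L, mu p - L - m) \<in> a"
        using p q pq by (auto simp: women_rank_def split: if_splits)
      then have nb: "(p - L, mu p - L - m) \<notin> b" using only[of p "mu p"] p neq by auto
      define t where "t = mu p"
      have t: "t < ?n" "L + m \<le> t" using lt p x by (auto simp: t_def)
      have "mu t \<noteq> t"
      proof
        assume "mu t = t"
        then have "p = t" using bij p t unfolding t_def bij_betw_def inj_on_def by auto
        then show False using t p by simp
      qed
      then have "men_rank L m b t p \<le> men_rank L m b t t"
        using D[of t p] t p by (auto simp: women_rank_def t_def)
      then show False using t p nb x L by (auto simp: men_rank_def t_def split: if_splits)
    next
      case 2
      then have ub: "L \<le> u" "u < L + m" "(u - L, q - L - m) \<in> b"
        using p q pq L by (auto simp: men_rank_def split: if_splits)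
      then have na: "(u - L, q - L - m) \<notin> a" using only[of u q] q u neq by auto
      obtain v where v: "v < ?n" "mu v = u" using ex[OF u(1)] by blast
      have "v \<noteq> u" using v u ub q by auto
      moreover have "men_rank L m b u v \<le> men_rank L m b u u"
        using D[of u v] v u ub na q by (auto simp: women_rank_def)
      ultimately show False using ub L by (auto simp: men_rank_def split: if_splits)
    qed
  qed
  show ?thesis using \<open>k < L\<close>
  proof (induction k)
    case 0
    show ?case
    proof
      assume eq: "mu 0 = 0"
      \<comment> \<open>Woman \<open>q\<close> is \<open>t_j\<close>: her default has eloped, so she
        wants \<open>d_0\<close>, who ranks her above \<open>c_0\<close>.\<close>
      have "mu q \<noteq> q"
      proof
        assume "mu q = q"
        then have "p = q" using mu_p bij p q unfolding bij_betw_def inj_on_def by auto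
        then show False using p q by simp
      qed
      moreover have "mu q \<noteq> 0"
      proof
        assume "mu q = 0"
        then have "q = 0" using eq bij q unfolding bij_betw_def inj_on_def by auto
        then show False using q L by simp
      qed
      ultimately have "men_rank L m b 0 0 \<le> men_rank L m b 0 q"
        using D[of q 0] eq q L by (auto simp: women_rank_def)
      then show False using q L by (auto simp: men_rank_def)
    qed
  next
    case (Suc k)
    show ?case
    proof
      assume eq: "mu (Suc k) = Suc k"
      have "mu k \<noteq> Suc k"
      proof
        assume "mu k = Suc k"
        then have "k = Suc k" using eq bij Suc.prems unfolding bij_betw_def inj_on_def by auto
        then show False by simp
      qed
      then have "men_rank L m b (Suc k) (Suc k) \<le> men_rank L m b (Suc k) k"
        using D[of k "Suc k"] eq Suc by (auto simp: women_rank_def)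
      then show False using Suc.prems by (auto simp: men_rank_def)
    qed
  qed
qed

text \<open>Default spouses share an index: \<open>p\<close> is \<open>u_i\<close> as an argument
  and \<open>s_i\<close> as a value, \<open>q\<close> is \<open>t_j\<close> as an argument and
  \<open>v_j\<close> as a value.\<close>

definition shifted_marriage :: "nat \<Rightarrow> nat \<Rightarrow> nat \<Rightarrow> nat \<Rightarrow> nat" where
  "shifted_marriage L p q w =
    (if w = p then q else if w = q then 0 else if Suc w < L then Suc w
     else if Suc w = L then p else w)"

text \<open>An explicit witness makes the minimum in \<open>dist_stable\<close> range over a
  nonempty set. Most men have a wife of rank 0; the exceptions are \<open>s_i\<close>, whose better
  choice \<open>u_i\<close> is content, and each \<open>v\<close> still at his default, whose better
  choices do not want him.\<close>

lemma stable_shifted_marriage_if_intersecting: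
  assumes L: "0 < L" and int: "a \<inter> b = {(i, j)}" and ij: "i < m" "j < m"
  shows "stable (L + 2 * m) (women_profile L m a) (men_profile L m b)
    (shifted_marriage L (L + i) (L + m + j))"
proof (rule stable_rankedI)
  let ?n = "L + 2 * m"
  define p where "p = L + i"
  define q where "q = L + m + j"
  have p: "L \<le> p" "p < L + m" "p < ?n" and q: "L + m \<le> q" "q < ?n"
    using ij by (auto simp: p_def q_def)
  have pq: "(p - L, q - L - m) \<in> a" "(p - L, q - L - m) \<in> b" using int by (auto simp: p_def q_def)
  have only: "u = p \<and> x = q" if "L \<le> u" "L + m \<le> x" "(u - L, x - L - m) \<in> a"
    "(u - L, x - L - m) \<in> b" for u x
  proof -
    have "(u - L, x - L - m) \<in> a \<inter> b" using that by blast
    then have "u - L = i" "x - L - m = j" using int by auto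
    then show ?thesis using that by (auto simp: p_def q_def)
  qed
  let ?mu = "shifted_marriage L (L + i) (L + m + j)"
  have mu: "?mu = shifted_marriage L p q" by (simp add: p_def q_def)
  show "bij_betw ?mu {..<?n} {..<?n}"
  proof -
    have "?mu ` {..<?n} \<subseteq> {..<?n}"
      using p q L unfolding mu by (auto simp: shifted_marriage_def)
    moreover have "inj_on ?mu {..<?n}"
      using p q L unfolding mu inj_on_def by (auto simp: shifted_marriage_def split: if_splits)
    ultimately show ?thesis
      unfolding bij_betw_def using endo_inj_surj[of "{..<?n}" ?mu] by blast
  qed
  fix w w'
  assume w: "w < ?n" "w' < ?n" "w \<noteq> w'"
    and W: "women_rank L m a w (?mu w') \<le> women_rank L m a w (?mu w)"
    and M: "men_rank L m b (?mu w') w \<le> men_rank L m b (?mu w') w'"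
  consider "w' = p" | "w' = q" | "Suc w' < L" | "Suc w' = L" | "L \<le> w'" "w' < L + m" "w' \<noteq> p"
    | "L + m \<le> w'" "w' \<noteq> q" using p q by linarith
  then show False
  proof cases
    case 1
    then have m': "?mu w' = q" using p q unfolding mu by (auto simp: shifted_marriage_def)
    have wb: "L \<le> w" "w < L + m" "(w - L, q - L - m) \<in> b"
      using M p q pq 1 L unfolding m' by (auto simp: men_rank_def split: if_splits)
    then have na: "(w - L, q - L - m) \<notin> a" using only[of w q] q w 1 by auto
    have "?mu w = w" using wb w 1 p q unfolding mu by (auto simp: shifted_marriage_def)
    then show False using W wb na q unfolding m' by (auto simp: women_rank_def split: if_splits)
  next
    case 2
    then have m': "?mu w' = 0" using p q L unfolding mu by (auto simp: shifted_marriage_def)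
    have wt: "L + m \<le> w"
      using M q 2 L unfolding m' by (auto simp: men_rank_def split: if_splits)
    have "?mu w = w" using wt w 2 p q L unfolding mu by (auto simp: shifted_marriage_def)
    then show False using W wt L unfolding m' by (auto simp: women_rank_def split: if_splits)
  next
    case 3
    then have m': "?mu w' = Suc w'" using p q unfolding mu by (auto simp: shifted_marriage_def)
    show False using M 3 w unfolding m' by (auto simp: men_rank_def split: if_splits)
  next
    case 4
    then have m': "?mu w' = p" using p q unfolding mu by (auto simp: shifted_marriage_def)
    have "w = p" using M p 4 w L unfolding m' by (auto simp: men_rank_def split: if_splits)
    moreover have "?mu p = q" using p q unfolding mu by (auto simp: shifted_marriage_def)
    ultimately show False using W p q pq unfolding m' by (auto simp: women_rank_def split: if_splits)
  next
    case 5
    then have m': "?mu w' = w'" using p q unfolding mu by (auto simp: shifted_marriage_def)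
    show False using M 5 w L unfolding m' by (auto simp: men_rank_def split: if_splits)
  next
    case 6
    then have m': "?mu w' = w'" using p q L unfolding mu by (auto simp: shifted_marriage_def)
    have wb: "L \<le> w" "w < L + m" "(w - L, w' - L - m) \<in> b"
      using M 6 w L unfolding m' by (auto simp: men_rank_def split: if_splits)
    then have na: "(w - L, w' - L - m) \<notin> a" using only[of w w'] 6 by auto
    have "women_rank L m a w (?mu w) < 2"
    proof (cases "w = p")
      case True
      then have "?mu w = q" using p q unfolding mu by (auto simp: shifted_marriage_def)
      then show ?thesis using True p q pq by (auto simp: women_rank_def)
    next
      case False
      then have "?mu w = w" using wb p q unfolding mu by (auto simp: shifted_marriage_def)
      then show ?thesis using wb by (auto simp: women_rank_def)
    qed
    moreover have "women_rank L m a w w' = 2" using wb na 6 by (auto simp: women_rank_def)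
    ultimately show False using W unfolding m' by simp
  qed
qed

subsection \<open>The lower bound\<close>

lemma card_marriage_pairs_Int:
  "card (marriage_pairs n mu \<inter> marriage_pairs n mu') = card {w. w < n \<and> mu w = mu' w}"
proof -
  have "marriage_pairs n mu \<inter> marriage_pairs n mu' = (\<lambda>w. (w, mu w)) ` {w. w < n \<and> mu w = mu' w}"
    by (auto simp: marriage_pairs_def)
  then show ?thesis by (simp add: card_image inj_on_def)
qed

lemma almost_stable_near_stable:
  assumes "almost_stable eps n pW pM mu" and ex: "stable n pW pM nu"
  shows "\<exists>mu'. stable n pW pM mu' \<and> real (divorce_dist n mu mu') \<le> eps * n"
proof -
  let ?D = "{divorce_dist n mu mu' | mu'. stable n pW pM mu'}"
  have "?D \<subseteq> {..n}" by (auto simp: divorce_dist_def)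
  then have "finite ?D" by (rule finite_subset) simp
  moreover have "?D \<noteq> {}" using ex by auto
  ultimately have "Min ?D \<in> ?D" by (rule Min_in)
  then obtain mu' where "stable n pW pM mu'" "dist_stable n pW pM mu = divorce_dist n mu mu'"
    by (auto simp: dist_stable_def)
  then show ?thesis using assms by (auto simp: almost_stable_def)
qed

text \<open>No chain woman can agree with both, so the two agreement counts sum to at most
  \<open>n + 2 * m\<close> with \<open>n = L + 2 * m\<close>, while each is at least
  \<open>(1 - eps) * n\<close>. The threshold 1/2 arises here.\<close>

lemma marriages_near_id_and_shift:
  assumes "\<forall>k < L. mu' k = k" "\<forall>k < L. mu'' k \<noteq> k"
    and "real (divorce_dist (L + 2 * m) mu mu') \<le> eps * real (L + 2 * m)"
    and "real (divorce_dist (L + 2 * m) mu mu'') \<le> eps * real (L + 2 * m)"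
  shows "(1 - 2 * eps) * real (L + 2 * m) \<le> 2 * real m"
proof -
  let ?n = "L + 2 * m"
  let ?X = "{w. w < ?n \<and> mu w = mu' w}" and ?Y = "{w. w < ?n \<and> mu w = mu'' w}"
  have "?X \<inter> ?Y \<subseteq> {L..<?n}"
  proof
    fix w assume w: "w \<in> ?X \<inter> ?Y"
    then have "mu' w = mu'' w" by simp
    then have "\<not> w < L" using assms(1,2) by metis
    then show "w \<in> {L..<?n}" using w by simp
  qed
  then have "card (?X \<inter> ?Y) \<le> card {L..<?n}" by (intro card_mono) auto
  moreover have "card (?X \<union> ?Y) \<le> card {..<?n}" by (intro card_mono) auto
  moreover have "card ?X + card ?Y = card (?X \<union> ?Y) + card (?X \<inter> ?Y)"
    by (rule card_Un_Int) auto
  ultimately have "card ?X + card ?Y \<le> ?n + 2 * m" by simp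
  then have sum: "real (card ?X) + real (card ?Y) \<le> real ?n + 2 * real m"
    by linarith
  have "real ?n - real (card ?X) \<le> eps * real ?n" "real ?n - real (card ?Y) \<le> eps * real ?n"
    using assms(3,4) unfolding divorce_dist_def card_marriage_pairs_Int by linarith+
  then show ?thesis using sum by (simp add: algebra_simps)
qed

lemma rand_solves_cost_bound:
  fixes eps :: real
  assumes R: "rand_solves eps (L + 2 * m) R" and c: "rand_cost (L + 2 * m) R \<le> enat c"
    and L: "0 < L" and m: "0 < m" and far: "2 * real m < (1 - 2 * eps) * real (L + 2 * m)"
  shows "1 \<le> 72 * 2 ^ c * skew_rate powr (real m ^ 2 / 100)"
proof -
  let ?n = "L + 2 * m" and ?U = "{..<m} \<times> {..<m}"
  let ?W = "women_profile L m" and ?M = "men_profile L m"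
  \<comment> \<open>Acceptance may not depend on the inputs, so closeness is to any
    \<open>mu'\<close> that fixes the chain, stable or not.\<close>
  define acc where "acc mu \<longleftrightarrow>
    (\<exists>mu'. (\<forall>k < L. mu' k = k) \<and> real (divorce_dist ?n mu mu') \<le> eps * real ?n)" for mu
  have valid: "(?W a, ?M b) \<in> valid_inputs ?n" for a b
    by (simp add: valid_inputs_def pref_profile_ranked_profile)
  have prob: "2/3 \<le> measure_pmf.prob R {P. almost_stable eps ?n (?W a) (?M b) (run P (?W a) (?M b))}"
    for a b
    using R valid[of a b] by (auto simp: rand_solves_def)
  have "1 \<le> 72 * 2 ^ c * skew_rate powr (card ?U / 100)"
  proof (rule unique_disjointness_cost[where acc = acc and f = ?W and g = ?M])
    show "finite ?U" "?U \<noteq> {}" using m by auto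
    show "bits P (?W a) (?M b) \<le> c" if "P \<in> set_pmf R" for P a b
    proof -
      have "enat (bits P (?W a) (?M b)) \<le> (SUP P \<in> set_pmf R. enat (bits P (?W a) (?M b)))"
        using that by (rule SUP_upper)
      also have "\<dots> \<le> rand_cost ?n R"
        unfolding rand_cost_def using valid[of a b] by (rule SUP_upper2) simp
      also note c
      finally show ?thesis by simp
    qed
    show "2/3 \<le> measure_pmf.prob R {P. acc (run P (?W a) (?M b))}" if "a \<inter> b = {}" for a b
    proof -
      have "acc mu" if as: "almost_stable eps ?n (?W a) (?M b) mu" for mu
        using almost_stable_near_stable[OF as stable_id_if_disjoint[OF L \<open>a \<inter> b = {}\<close>]]
          stable_fixes_chain_if_disjoint[OF L \<open>a \<inter> b = {}\<close>]
        unfolding acc_def by blast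
      then have "measure_pmf.prob R {P. almost_stable eps ?n (?W a) (?M b) (run P (?W a) (?M b))}
          \<le> measure_pmf.prob R {P. acc (run P (?W a) (?M b))}"
        by (intro measure_pmf.finite_measure_mono) auto
      then show ?thesis using prob[of a b] by linarith
    qed
    show "measure_pmf.prob R {P. acc (run P (?W a) (?M b))} \<le> 1/3"
      if "a \<subseteq> ?U" and int: "a \<inter> b = {x}" for a b x
    proof -
      obtain i j where x: "x = (i, j)" by (cases x)
      have ij: "i < m" "j < m" using that x by auto
      note int' = int[unfolded x]
      have "\<not> acc mu" if as: "almost_stable eps ?n (?W a) (?M b) mu" for mu
      proof
        assume "acc mu"
        then obtain mu' where "\<forall>k < L. mu' k = k" "real (divorce_dist ?n mu mu') \<le> eps * real ?n"
          unfolding acc_def by blast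
        moreover obtain mu'' where "stable ?n (?W a) (?M b) mu''"
          "real (divorce_dist ?n mu mu'') \<le> eps * real ?n"
          using almost_stable_near_stable[OF as stable_shifted_marriage_if_intersecting[OF L int' ij]]
          by blast
        moreover have "\<forall>k < L. mu'' k \<noteq> k"
          using stable_shifts_chain_if_intersecting[OF L int' ij calculation(3)] by blast
        ultimately have "(1 - 2 * eps) * real ?n \<le> 2 * real m"
          by (intro marriages_near_id_and_shift)
        then show False using far by linarith
      qed
      then have "measure_pmf.prob R {P. acc (run P (?W a) (?M b))}
          \<le> measure_pmf.prob R (UNIV - {P. almost_stable eps ?n (?W a) (?M b) (run P (?W a) (?M b))})"
        by (intro measure_pmf.finite_measure_mono) auto
      also have "\<dots> = 1 - measure_pmf.prob R
          {P. almost_stable eps ?n (?W a) (?M b) (run P (?W a) (?M b))}"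
        using measure_pmf.prob_compl[of _ R] by simp
      finally show ?thesis using prob[of a b] by linarith
    qed
  qed
  then show ?thesis by (simp add: card_cartesian_product power2_eq_square)
qed

lemma rand_CC_le_det_CC: "rand_CC eps n \<le> det_CC eps n"
  unfolding det_CC_def
proof (rule INF_greatest)
  fix P assume "P \<in> {P. det_solves eps n P}"
  then have "rand_solves eps n (return_pmf P)"
    by (auto simp: det_solves_def rand_solves_def measure_return)
  moreover have "rand_cost n (return_pmf P) = det_cost n P"
    by (simp add: rand_cost_def det_cost_def)
  ultimately show "rand_CC eps n \<le> det_cost n P"
    unfolding rand_CC_def by (intro INF_lower2[of "return_pmf P"]) auto
qed

theorem theorem7:
  fixes eps :: real
  assumes "0 \<le> eps" and "eps < 1/2"
  shows "\<exists>c > 0. \<exists>N. \<forall>n \<ge> N.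
           enat (nat \<lceil>c * real n ^ 2\<rceil>) \<le> rand_CC eps n \<and>
           enat (nat \<lceil>c * real n ^ 2\<rceil>) \<le> det_CC eps n"
proof -
  \<comment> \<open>With \<open>m\<close> about \<open>k * n\<close>, the \<open>2 * m\<close> women
    outside the chain use at most half of the slack \<open>(1 - 2 * eps) * n\<close>.\<close>
  define k where "k = (1 - 2 * eps) / 4"
  define h where "h = - ln skew_rate / 100"
  \<comment> \<open>From \<open>m \<ge> k * n / 2\<close> follows
    \<open>h * m ^ 2 \<ge> 2 * c * n ^ 2\<close>; half of this absorbs \<open>ln 72\<close>.\<close>
  define c where "c = h * k ^ 2 / 8"
  have k: "0 < k" "k \<le> 1/4" using assms by (auto simp: k_def)
  have h: "0 < h" using skew_rate_pos skew_rate_less_1 by (simp add: h_def)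
  have c: "0 < c" using k h by (simp add: c_def)
  \<comment> \<open>\<open>2 / k\<close> keeps the loss from rounding \<open>m\<close> down within a
    factor 2, and \<open>ln 72 / c\<close> ensures \<open>ln 72 \<le> c * n\<close>.\<close>
  obtain N :: nat where N: "2 / k + ln 72 / c + 1 \<le> real N" using real_arch_simple by blast
  have lnc: "0 < ln 72 / c" using c by simp
  have "enat (nat \<lceil>c * real n ^ 2\<rceil>) \<le> rand_CC eps n" if n: "N \<le> n" for n
    unfolding rand_CC_def
  proof (rule INF_greatest)
    fix R assume "R \<in> {R. rand_solves eps n R}"
    then have R: "rand_solves eps n R" by simp
    have kn0: "0 < 2 / k" using k by simp
    have nbig: "2 / k + ln 72 / c + 1 \<le> real n" using N n by linarith
    have n2k: "2 / k \<le> real n" and n1: "1 \<le> real n" and nc: "ln 72 / c \<le> real n"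
      using nbig lnc kn0 by linarith+
    have kn: "2 \<le> k * real n" using n2k k by (simp add: field_simps)
    define m where "m = nat \<lfloor>k * real n\<rfloor>"
    define L where "L = n - 2 * m"
    have mle: "real m \<le> k * real n" using kn by (simp add: m_def)
    have "k * real n - 1 \<le> real m" using kn unfolding m_def by linarith
    then have mge: "k * real n / 2 \<le> real m" using kn by linarith
    have m0: "0 < m" using mge kn by linarith
    have "k * real n \<le> 1/4 * real n" using k by (intro mult_right_mono) auto
    then have m4: "4 * real m \<le> real n" using mle by linarith
    then have Ln: "n = L + 2 * m" "0 < L" using n1 m0 unfolding L_def by linarith+
    have far: "2 * real m < (1 - 2 * eps) * real (L + 2 * m)"
    proof -
      have "(1 - 2 * eps) * real n = 4 * (k * real n)" by (simp add: k_def)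
      then show ?thesis unfolding Ln(1)[symmetric] using mle kn by linarith
    qed
    show "enat (nat \<lceil>c * real n ^ 2\<rceil>) \<le> rand_cost n R"
    proof (cases "rand_cost n R")
      case (enat d)
      have "1 \<le> 72 * 2 ^ d * skew_rate powr (real m ^ 2 / 100)"
        by (rule rand_solves_cost_bound[OF _ _ Ln(2) m0 far])
           (use R enat Ln(1) in auto)
      then have "ln 1 \<le> ln (72 * 2 ^ d * skew_rate powr (real m ^ 2 / 100))"
        using skew_rate_pos by (subst ln_le_cancel_iff) auto
      also have "\<dots> = ln 72 + d * ln 2 + real m ^ 2 / 100 * ln skew_rate"
        using skew_rate_pos by (simp add: ln_mult ln_realpow ln_powr)
      finally have "h * real m ^ 2 \<le> ln 72 + d * ln 2" by (simp add: h_def mult.commute)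
      also have "d * ln 2 \<le> real d * 1"
        using ln_le_minus_one[of 2] by (intro mult_left_mono) auto
      finally have 1: "h * real m ^ 2 \<le> ln 72 + d" by simp
      have "2 * c * real n ^ 2 = h * (k * real n / 2) ^ 2"
        by (simp add: c_def power_mult_distrib power_divide)
      also have "\<dots> \<le> h * real m ^ 2"
        using mge h kn by (intro mult_left_mono power_mono) auto
      finally have 2: "2 * c * real n ^ 2 \<le> ln 72 + d" using 1 by linarith
      have "ln 72 \<le> c * real n" using nc c by (simp add: field_simps)
      also have "\<dots> \<le> c * real n ^ 2"
        using n1 c by (simp add: power2_eq_square)
      finally have "c * real n ^ 2 \<le> d" using 2 by linarith
      then show ?thesis unfolding enat by (simp add: nat_ceiling_le_eq)
    qed simp
  qed
  then show ?thesis using c rand_CC_le_det_CC order_trans by blast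
qed

end
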